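(* Let $\mathcal{T}_h$ be a shape-regular simplicial triangulation of a contractible polygonal domain $\Omega\subset\mathbb{R}^2$ and let $\mathcal{T}_h^{\rm PS}$ be its Powell--Sabin refinement, with set of singular vertices $\mathcal{S}_h$. Let $\{\varphi_z^{(j)}: z\in\mathcal{S}_h,\ j=1,\dots,n_z\}$ be the canonical basis of the space of piecewise constants on $\mathcal{T}_h^{\rm PS}$, where $\varphi_z^{(j)}$ equals $1$ on $K_z^{(j)}$ and $0$ on every other triangle. For each $z\in\mathcal{S}_h$ and $j\in\{2,\dots,n_z\}$, define $$\psi_z^{(j)}=\varphi_z^{(j)}+(-1)^j\varphi_z^{(1)}.$$ Then $\{\psi_z^{(j)}:\ z\in\mathcal{S}_h,\ j=2,\dots,n_z\}$ forms a basis of $$\hat{Y}_h^{\rm PS}=\{q\in\mathcal{P}_0(\mathcal{T}_h^{\rm PS}):\ \theta_z(q)=0\ \ \forall z\in\mathcal{S}_h\}.$$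
   Context: Triangulations are conforming. Powell--Sabin refinement $\mathcal{T}_h^{\rm PS}$ of $\mathcal{T}_h$: connect the incenter of each triangle $T\in\mathcal{T}_h$ to its three vertices; connect the incenters of each pair of adjacent (edge-sharing) triangles by a segment (which creates a split point on the common edge); if $T$ has a boundary edge, connect the midpoint of that edge to the incenter of $T$. Each triangle of $\mathcal{T}_h$ is thereby split into six subtriangles. A vertex in a simplicial triangulation is singular if the edges meeting at the vertex fall on exactly two straight lines. $\mathcal{S}_h^I$ and $\mathcal{S}_h^B$ denote the sets of interior and boundary singular vertices of $\mathcal{T}_h^{\rm PS}$ (they are the edge split points, in one-to-one correspondence with the interior and boundary edges of $\mathcal{T}_h$, respectively), and $\mathcal{S}_h=\mathcal{S}_h^I\cup\mathcal{S}_h^B$. For $z\in\mathcal{S}_h$, $\mathcal{T}_z=\{K_z^{(1)},\dots,K_z^{(n_z)}\}\subset\mathcal{T}_h^{\rm PS}$ is the set of triangles having $z$ as a vertex, where $n_z=4$ if $z\in\mathcal{S}_h^I$ and $n_z=2$ if $z\in\mathcal{S}_h^B$, labeled so that $K_z^{(j)}$ and $K_z^{(j+1)}$ share a common edge. Each triangle of $\mathcal{T}_h^{\rm PS}$ equals $K_z^{(j)}$ for exactly one pair $(z,j)$. $\mathcal{P}_0(\mathcal{T}_h^{\rm PS})$ is the space of piecewise constant functions on $\mathcal{T}_h^{\rm PS}$. For $q\in\mathcal{P}_0(\mathcal{T}_h^{\rm PS})$, $\theta_z(q)=q|_{K_z^{(1)}}(z)-q|_{K_z^{(2)}}(z)+q|_{K_z^{(3)}}(z)-q|_{K_z^{(4)}}(z)$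 if $z\in\mathcal{S}_h^I$, and $\theta_z(q)=q|_{K_z^{(1)}}(z)-q|_{K_z^{(2)}}(z)$ if $z\in\mathcal{S}_h^B$. *)

theory Defs
  imports "HOL-Analysis.Analysis" "HOL-Library.Function_Algebras"
begin

text \<open>Pointwise real vector space structure on functions, so that the library notions
  \<open>span\<close> and \<open>independent\<close> apply to spaces of real-valued functions.\<close>

instantiation "fun" :: (type, real_vector) real_vector
begin

definition scaleR_fun :: "real \<Rightarrow> ('a \<Rightarrow> 'b) \<Rightarrow> 'a \<Rightarrow> 'b" where
  "scaleR_fun c f = (\<lambda>x. c *\<^sub>R f x)"

instance
  by standard (auto simp: scaleR_fun_def fun_eq_iff algebra_simps)

end

lemma scaleR_fun_apply [simp]: "(c *\<^sub>R f) x = c *\<^sub>R f x"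
  by (simp add: scaleR_fun_def)


section \<open>Polygonal domains and their triangulations\<close>

type_synonym point = "real^2"
type_synonym mesh = "(real^2) set set"

text \<open>The condition \<open>\<Omega> = interior (closure \<Omega>)\<close> says that the domain has no slits:
  a boundary edge has the domain on one side only.\<close>

definition polygonal_domain :: "point set \<Rightarrow> bool" where
  "polygonal_domain \<Omega> \<longleftrightarrow>
     \<Omega> \<noteq> {} \<and> open \<Omega> \<and> connected \<Omega> \<and> bounded \<Omega> \<and> \<Omega> = interior (closure \<Omega>) \<and>
     (\<exists>S. finite S \<and> (\<forall>s\<in>S. \<exists>a b. s = closed_segment a b) \<and> frontier \<Omega> = \<Union>S)"

text \<open>The library's \<^const>\<open>triangulation\<close> comprises finiteness and conformity (any two members
  meet in a common face).\<close>

definition triangulates :: "mesh \<Rightarrow> point set \<Rightarrow> bool" where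
  "triangulates \<T> \<Omega> \<longleftrightarrow> triangulation \<T> \<and> (\<forall>T\<in>\<T>. 2 simplex T) \<and> \<Union>\<T> = closure \<Omega>"

definition inscribed_disc :: "point set \<Rightarrow> point \<Rightarrow> real \<Rightarrow> bool" where
  "inscribed_disc T p r \<longleftrightarrow>
     0 < r \<and> cball p r \<subseteq> T \<and> (\<forall>e. e edge_of T \<longrightarrow> cball p r \<inter> e \<noteq> {})"

definition incenter :: "point set \<Rightarrow> point" where
  "incenter T = (THE p. \<exists>r. inscribed_disc T p r)"

definition inradius :: "point set \<Rightarrow> real" where
  "inradius T = (THE r. \<exists>p. inscribed_disc T p r)"

definition shape_regular :: "real \<Rightarrow> mesh \<Rightarrow> bool" where
  "shape_regular \<sigma> \<T> \<longleftrightarrow> (\<forall>T\<in>\<T>. diameter T \<le> \<sigma> * inradius T)"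


section \<open>The Powell--Sabin refinement\<close>

text \<open>\<open>split_point \<T> e z\<close>: the edge \<open>e\<close> of \<open>\<T>\<close> is split at \<open>z\<close>. If \<open>e\<close> is shared by two
  triangles, \<open>z\<close> is where the segment joining their incenters meets \<open>e\<close>; if \<open>e\<close> belongs to one
  triangle only (a boundary edge), \<open>z\<close> is its midpoint.\<close>

definition split_point :: "mesh \<Rightarrow> point set \<Rightarrow> point \<Rightarrow> bool" where
  "split_point \<T> e z \<longleftrightarrow>
     (\<exists>T\<in>\<T>. \<exists>T'\<in>\<T>. T \<noteq> T' \<and> e edge_of T \<and> e edge_of T' \<and>
        z \<in> e \<inter> closed_segment (incenter T) (incenter T')) \<or>
     ((\<exists>!T. T \<in> \<T> \<and> e edge_of T) \<and> (\<exists>a b. e = closed_segment a b \<and> z = midpoint a b))"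

definition powell_sabin :: "mesh \<Rightarrow> mesh" where
  "powell_sabin \<T> =
     {convex hull {v, z, incenter T} | v z T e.
        T \<in> \<T> \<and> e edge_of T \<and> v extreme_point_of e \<and> split_point \<T> e z}"


section \<open>Singular vertices\<close>

definition mesh_vertices :: "mesh \<Rightarrow> point set" where
  "mesh_vertices M = {z. \<exists>K\<in>M. z extreme_point_of K}"

definition mesh_edges :: "mesh \<Rightarrow> point set set" where
  "mesh_edges M = {e. \<exists>K\<in>M. e edge_of K}"

text \<open>The affine hulls of the edges meeting at \<open>z\<close> are the straight lines these edges fall on.\<close>

definition singular_vertex :: "mesh \<Rightarrow> point \<Rightarrow> bool" where
  "singular_vertex M z \<longleftrightarrow>
     z \<in> mesh_vertices M \<and>
     card {affine hull e | e. e \<in> mesh_edges M \<and> z extreme_point_of e} = 2"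

definition singular_interior :: "point set \<Rightarrow> mesh \<Rightarrow> point set" where
  "singular_interior \<Omega> M = {z \<in> \<Omega>. singular_vertex M z}"

definition singular_boundary :: "point set \<Rightarrow> mesh \<Rightarrow> point set" where
  "singular_boundary \<Omega> M = {z \<in> frontier \<Omega>. singular_vertex M z}"

definition singular_vertices :: "point set \<Rightarrow> mesh \<Rightarrow> point set" where
  "singular_vertices \<Omega> M = singular_interior \<Omega> M \<union> singular_boundary \<Omega> M"

definition vertex_star :: "mesh \<Rightarrow> point \<Rightarrow> mesh" where
  "vertex_star M z = {K \<in> M. z extreme_point_of K}"

definition star_size :: "point set \<Rightarrow> mesh \<Rightarrow> point \<Rightarrow> nat" where
  "star_size \<Omega> M z = (if z \<in> singular_interior \<Omega> M then 4 else 2)"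

definition star_labelling :: "point set \<Rightarrow> mesh \<Rightarrow> (point \<Rightarrow> nat \<Rightarrow> point set) \<Rightarrow> bool" where
  "star_labelling \<Omega> M K \<longleftrightarrow>
     (\<forall>z\<in>singular_vertices \<Omega> M.
        bij_betw (K z) {1..star_size \<Omega> M z} (vertex_star M z) \<and>
        (\<forall>j\<in>{1..<star_size \<Omega> M z}. \<exists>e. e edge_of K z j \<and> e edge_of K z (j + 1)))"


section \<open>Piecewise constants\<close>

text \<open>Piecewise constants are determined only up to their values on the edges; the representative
  chosen vanishes off the open triangles. Accordingly \<open>q|K\<close> at a point of the closed triangle
  \<open>K\<close> is the limit from the interior of \<open>K\<close>.\<close>

definition piecewise_constants :: "mesh \<Rightarrow> (point \<Rightarrow> real) set" where
  "piecewise_constants M =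
     {q. (\<forall>K\<in>M. \<exists>c. \<forall>x\<in>interior K. q x = c) \<and> (\<forall>x. x \<notin> (\<Union>K\<in>M. interior K) \<longrightarrow> q x = 0)}"

definition value_from :: "(point \<Rightarrow> real) \<Rightarrow> point set \<Rightarrow> point \<Rightarrow> real" where
  "value_from q K z = Lim (at z within interior K) q"

definition \<theta> ::
  "point set \<Rightarrow> mesh \<Rightarrow> (point \<Rightarrow> nat \<Rightarrow> point set) \<Rightarrow> point \<Rightarrow> (point \<Rightarrow> real) \<Rightarrow> real" where
  "\<theta> \<Omega> M K z q =
     (if z \<in> singular_interior \<Omega> M
      then value_from q (K z 1) z - value_from q (K z 2) z
           + value_from q (K z 3) z - value_from q (K z 4) z
      else value_from q (K z 1) z - value_from q (K z 2) z)"

definition Y_hat ::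
  "point set \<Rightarrow> mesh \<Rightarrow> (point \<Rightarrow> nat \<Rightarrow> point set) \<Rightarrow> (point \<Rightarrow> real) set" where
  "Y_hat \<Omega> M K =
     {q \<in> piecewise_constants M. \<forall>z\<in>singular_vertices \<Omega> M. \<theta> \<Omega> M K z q = 0}"

definition \<phi> :: "(point \<Rightarrow> nat \<Rightarrow> point set) \<Rightarrow> point \<Rightarrow> nat \<Rightarrow> point \<Rightarrow> real" where
  "\<phi> K z j = indicat_real (interior (K z j))"

definition \<psi> :: "(point \<Rightarrow> nat \<Rightarrow> point set) \<Rightarrow> point \<Rightarrow> nat \<Rightarrow> point \<Rightarrow> real" where
  "\<psi> K z j = \<phi> K z j + ((-1) ^ j) *\<^sub>R \<phi> K z 1"

text \<open>An indexed family is a basis of \<open>V\<close> if it is injective and its range is linearly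
  independent with span \<open>V\<close>.\<close>

definition family_basis :: "('i \<Rightarrow> 'v::real_vector) \<Rightarrow> 'i set \<Rightarrow> 'v set \<Rightarrow> bool" where
  "family_basis f I V \<longleftrightarrow> inj_on f I \<and> independent (f ` I) \<and> span (f ` I) = V"

end

theory Submission
  imports Defs
begin

text \<open>
  The theorem is linear algebra on top of one geometric fact: \<^emph>\<open>the triangles of the refinement
  have pairwise disjoint, nonempty interiors, and each of them has exactly one singular vertex\<close>.

  Given this fact, the stars of the singular vertices partition the refinement, so a piecewise
  constant is the same thing as an arbitrary choice of values \<open>c z j\<close> on the labelled triangles,
  and membership in \<^const>\<open>Y_hat\<close> means that the alternating sum of \<open>c z 1, \<dots>, c z n\<close> vanishes
  for every singular vertex \<open>z\<close> with a star of \<open>n\<close> triangles. This equation determines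
  \<open>c z 1\<close> from \<open>c z j\<close>, \<open>j \<ge> 2\<close>, which are free. Evaluation on the triangles with
  \<open>j \<ge> 2\<close> is therefore a system of coordinates on the space, and the functions \<^const>\<open>\<psi>\<close> are the
  family dual to it (lemmas \<open>psi_pt\<close>, \<open>Y_hat_iff\<close> and \<open>family_basis_psi\<close>).

  The geometric fact rests on the position of the split points. The incenter of a triangle \<open>a b c\<close>
  is the convex combination of \<open>a\<close>, \<open>b\<close>, \<open>c\<close> weighted by the lengths of the opposite sides
  (\<open>incenter_triangle\<close>), so it lies in the interior, and its orthogonal projection to any side falls
  strictly between the endpoints of that side (\<open>incenter_acute\<close>). Two triangles with a common edge
  lie on opposite sides of it; hence the segment of their incenters crosses the edge in a single
  relatively interior point (\<open>incenter_segment_meets_edge\<close>), and every edge has a unique split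
  point, which is no vertex (\<open>split_point_ex1\<close>).

  A subtriangle has as vertices a vertex \<open>a\<close> of the triangulation, a split point \<open>z\<close> and an
  incenter. The edges at \<open>z\<close> fall on the line of the split edge and on the line of the incenters.
  At \<open>a\<close>, two edges of one triangle and the segment to its incenter give three lines, and the
  segments from an incenter to the three vertices of its triangle give three lines as well. So
  \<open>z\<close> is the only singular vertex of the subtriangle (\<open>singular_vertex_iff\<close>). Conformity is used
  throughout in the form of \<open>faces_eq\<close>: faces of triangles of the mesh whose relative interiors
  meet are equal. Disjointness (\<open>subtriangles_disjoint\<close>) holds since an interior point of a
  subtriangle determines its central projection from the incenter to the boundary of the
  triangle, hence the half-edge on which the subtriangle stands.
\<close>

section \<open>Orientation and barycentric coordinates in the plane\<close>

text \<open>Twice the signed area of the triangle \<open>a b c\<close>; for \<open>a \<noteq> b\<close>, as a function of \<open>c\<close>, an affine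
  function that vanishes exactly on the line through \<open>a\<close> and \<open>b\<close>, with different signs on its two sides.\<close>

definition orient :: "point \<Rightarrow> point \<Rightarrow> point \<Rightarrow> real" where
  "orient a b c = (b$1 - a$1) * (c$2 - a$2) - (b$2 - a$2) * (c$1 - a$1)"

lemma orient_rotate: "orient b c a = orient a b c"
  and orient_swap: "orient a c b = - orient a b c"
  and orient_degenerate [simp]: "orient a a b = 0" "orient a b a = 0" "orient a b b = 0"
  by (simp_all add: orient_def algebra_simps)

lemma orient_affine2:
  assumes "u + v = 1"
  shows "orient a b (u *\<^sub>R x + v *\<^sub>R y) = u * orient a b x + v * orient a b y"
proof -
  have v: "v = 1 - u" using assms by simp
  show ?thesis unfolding v by (simp add: orient_def algebra_simps)
qed

lemma orient_affine3:
  assumes "u + v + w = 1"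
  shows "orient a b (u *\<^sub>R x + v *\<^sub>R y + w *\<^sub>R z) =
           u * orient a b x + v * orient a b y + w * orient a b z"
proof -
  have w: "w = 1 - u - v" using assms by simp
  show ?thesis unfolding w by (simp add: orient_def algebra_simps)
qed

lemma orient_sum: "orient b c x + orient c a x + orient a b x = orient a b c"
  by (simp add: orient_def algebra_simps)

text \<open>The barycentric coordinates of \<open>x\<close> in the triangle \<open>a b c\<close> are quotients of signed areas.\<close>

lemma barycentric:
  "orient a b c *\<^sub>R x = orient b c x *\<^sub>R a + orient c a x *\<^sub>R b + orient a b x *\<^sub>R c"
  unfolding vec_eq_iff forall_2 vector_add_component vector_scaleR_component orient_def
  by (intro conjI; simp only: real_scaleR_def; algebra)

lemma barycentric_normalized:
  assumes "orient a b c \<noteq> 0"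
  shows "x = (orient b c x / orient a b c) *\<^sub>R a + (orient c a x / orient a b c) *\<^sub>R b
           + (orient a b x / orient a b c) *\<^sub>R c"
proof -
  have "x = (1 / orient a b c) *\<^sub>R (orient a b c *\<^sub>R x)"
    using assms by simp
  also have "\<dots> = (1 / orient a b c) *\<^sub>R
      (orient b c x *\<^sub>R a + orient c a x *\<^sub>R b + orient a b x *\<^sub>R c)"
    by (rule arg_cong[OF barycentric])
  finally show ?thesis
    by (simp add: scaleR_add_right)
qed

lemma orient_eq_0_iff_collinear: "orient a b c = 0 \<longleftrightarrow> collinear {a, b, c}"
proof
  assume "collinear {a, b, c}"
  then obtain u where "a = c \<or> b = u *\<^sub>R a + (1 - u) *\<^sub>R c"
    by (auto simp: collinear_3_expand)
  then show "orient a b c = 0"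
  proof
    assume b: "b = u *\<^sub>R a + (1 - u) *\<^sub>R c"
    have "orient a b c = orient c a b" by (simp add: orient_rotate)
    also have "\<dots> = 0" unfolding b by (subst orient_affine2) auto
    finally show ?thesis .
  qed simp
next
  assume 0: "orient a b c = 0"
  show "collinear {a, b, c}"
  proof (cases "a = b")
    case False
    define n where "n = (norm (b - a))\<^sup>2"
    have n: "n = (b$1 - a$1)\<^sup>2 + (b$2 - a$2)\<^sup>2"
      unfolding n_def power2_norm_eq_inner by (simp add: inner_vec_def sum_2 power2_eq_square)
    have n0: "n \<noteq> 0" using False by (simp add: n_def)
    define m where "m = (b - a) \<bullet> (c - a)"
    have m: "m = (b$1 - a$1) * (c$1 - a$1) + (b$2 - a$2) * (c$2 - a$2)"
      unfolding m_def by (simp add: inner_vec_def sum_2)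
    \<comment> \<open>As \<open>c - a\<close> is parallel to \<open>b - a\<close>, it equals its orthogonal projection to \<open>b - a\<close>.\<close>
    have "n *\<^sub>R (c - a) = m *\<^sub>R (b - a)"
      unfolding vec_eq_iff forall_2 using 0
      by (simp add: n m orient_def power2_eq_square) (auto; algebra)
    then have "(1/n) *\<^sub>R (n *\<^sub>R (c - a)) = (1/n) *\<^sub>R (m *\<^sub>R (b - a))" by simp
    then have "c - a = (m / n) *\<^sub>R (b - a)" using n0 by simp
    then have "c = (m / n) *\<^sub>R b + (1 - m / n) *\<^sub>R a" by (simp add: algebra_simps)
    then have "collinear {b, c, a}" by (auto simp: collinear_3_expand)
    then show ?thesis by (simp add: insert_commute)
  qed simp
qed

lemma triangle_iff_orient:
  assumes "orient a b c > 0"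
  shows "x \<in> convex hull {a, b, c} \<longleftrightarrow> orient b c x \<ge> 0 \<and> orient c a x \<ge> 0 \<and> orient a b x \<ge> 0"
proof
  assume "x \<in> convex hull {a, b, c}"
  then obtain u v w where uvw: "0 \<le> u" "0 \<le> v" "0 \<le> w" "u + v + w = 1"
    and x: "x = u *\<^sub>R a + v *\<^sub>R b + w *\<^sub>R c"
    by (auto simp: convex_hull_3)
  show "orient b c x \<ge> 0 \<and> orient c a x \<ge> 0 \<and> orient a b x \<ge> 0"
    unfolding x using uvw assms orient_rotate[of b c a] orient_rotate[of c a b]
    by (simp add: orient_affine3)
next
  let ?D = "orient a b c"
  assume "orient b c x \<ge> 0 \<and> orient c a x \<ge> 0 \<and> orient a b x \<ge> 0"
  moreover have "orient b c x / ?D + orient c a x / ?D + orient a b x / ?D = 1"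
    using assms orient_sum[of b c x a] by (simp add: field_simps)
  ultimately show "x \<in> convex hull {a, b, c}"
    using assms barycentric_normalized[of a b c x] unfolding convex_hull_3
    by (intro CollectI exI[of _ "orient b c x / ?D"] exI[of _ "orient c a x / ?D"]
        exI[of _ "orient a b x / ?D"]) simp
qed

lemma interior_triangle:
  fixes a :: point
  assumes "\<not> collinear {a, b, c}"
  shows "x \<in> interior (convex hull {a, b, c}) \<longleftrightarrow>
    (\<exists>u v w. 0 < u \<and> 0 < v \<and> 0 < w \<and> u + v + w = 1 \<and> u *\<^sub>R a + v *\<^sub>R b + w *\<^sub>R c = x)"
  by (subst interior_convex_hull_3_minimal[OF assms]) auto

lemma segment_imp_orient_0:
  assumes "y \<in> closed_segment a b"
  shows "orient a b y = 0"
  using assms by (auto simp: closed_segment_def orient_affine2)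

lemma triangle_orient_0_imp_segment:
  assumes "orient a b c > 0" "x \<in> convex hull {a, b, c}" "orient a b x = 0"
  shows "x \<in> closed_segment a b"
proof -
  let ?D = "orient a b c"
  have nn: "orient b c x \<ge> 0" "orient c a x \<ge> 0"
    using assms by (simp_all add: triangle_iff_orient)
  have sum: "orient b c x / ?D = 1 - orient c a x / ?D"
    using assms orient_sum[of b c x a] by (simp add: field_simps)
  have "x = (1 - orient c a x / ?D) *\<^sub>R a + (orient c a x / ?D) *\<^sub>R b"
    using barycentric_normalized[of a b c x] assms sum by simp
  moreover have "0 \<le> orient c a x / ?D" "orient c a x / ?D \<le> 1"
    using nn assms sum by (auto simp: field_simps)
  ultimately show ?thesis unfolding closed_segment_def by blast
qed

section \<open>Faces of plane triangles\<close>

lemma edge_of_segment_triangle: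
  fixes a :: point
  assumes "\<not> collinear {a, b, c}"
  shows "e edge_of (convex hull {a, b, c}) \<longleftrightarrow>
    e = closed_segment a b \<or> e = closed_segment b c \<or> e = closed_segment c a"
proof -
  have dist: "a \<noteq> b" "b \<noteq> c" "c \<noteq> a" and ind: "\<not> affine_dependent {a, b, c}"
    using assms by (auto simp: collinear_3_eq_affine_dependent)
  have *: "aff_dim (convex hull C) = 1 \<longleftrightarrow> card C = 2" if "C \<subseteq> {a, b, c}" for C
    using aff_dim_affine_independent[OF affine_independent_subset[OF ind that]]
    by (simp add: aff_dim_convex_hull) linarith
  show ?thesis
  proof
    assume "e edge_of (convex hull {a, b, c})"
    then obtain C where C: "C \<subseteq> {a, b, c}" "e = convex hull C" "card C = 2"
      unfolding edge_of_def face_of_convex_hull_affine_independent[OF ind] using * by blast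
    then obtain x y where "C = {x, y}" "x \<noteq> y" by (auto simp: card_2_iff)
    with C show "e = closed_segment a b \<or> e = closed_segment b c \<or> e = closed_segment c a"
      by (auto simp: segment_convex_hull insert_commute)
  next
    assume "e = closed_segment a b \<or> e = closed_segment b c \<or> e = closed_segment c a"
    then obtain x y where "e = convex hull {x, y}" "{x, y} \<subseteq> {a, b, c}" "x \<noteq> y"
      using dist unfolding segment_convex_hull by blast
    then obtain C where C: "C \<subseteq> {a, b, c}" "e = convex hull C" "card C = 2"
      using card_2_iff by metis
    then show "e edge_of (convex hull {a, b, c})"
      unfolding edge_of_def face_of_convex_hull_affine_independent[OF ind] using *[OF C(1)] by blast
  qed
qed

lemma extreme_point_of_triangle:
  fixes p :: point
  assumes "\<not> collinear {p, q, r}"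
  shows "x extreme_point_of (convex hull {p, q, r}) \<longleftrightarrow> x = p \<or> x = q \<or> x = r"
proof -
  have "\<not> affine_dependent {p, q, r}" using assms collinear_3_eq_affine_dependent by blast
  then show ?thesis by (simp add: extreme_point_of_convex_hull_affine_independent)
qed

lemma edge_of_2_simplex:
  fixes T :: "point set"
  assumes "2 simplex T" "e edge_of T" "a extreme_point_of e"
  obtains b c where "\<not> collinear {a, b, c}" "T = convex hull {a, b, c}" "e = closed_segment a b"
proof -
  obtain C where C: "\<not> affine_dependent C" "card C = 3" "T = convex hull C"
    using assms(1) unfolding simplex_def by auto
  obtain x y z where "C = {x, y, z}" "x \<noteq> y" "x \<noteq> z" "y \<noteq> z"
    using C(2) by (auto simp: card_3_iff)
  with C have nc: "\<not> collinear {x, y, z}" and T: "T = convex hull {x, y, z}"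
    by (auto simp: collinear_3_eq_affine_dependent)
  note found = that
  have result: thesis
    if pqr: "\<not> collinear {p, q, r}" "T = convex hull {p, q, r}" "e = closed_segment p q" for p q r
  proof -
    have "a = p \<or> a = q"
      using assms(3) unfolding pqr(3) by (simp add: extreme_point_of_segment)
    then show thesis
    proof
      assume "a = p"
      then show thesis using found[of q r] pqr by blast
    next
      assume "a = q"
      moreover have "{q, p, r} = {p, q, r}" "closed_segment q p = closed_segment p q"
        by (auto simp: closed_segment_commute)
      ultimately show thesis using found[of p r] pqr by simp
    qed
  qed
  have "{y, z, x} = {x, y, z}" "{z, x, y} = {x, y, z}" by auto
  then show ?thesis
    using result[of x y z] result[of y z x] result[of z x y] nc T
      edge_of_segment_triangle[OF nc] assms(2) by metis
qed

lemma segment_edge_of_2_simplex: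
  fixes T :: "point set"
  assumes "2 simplex T" "closed_segment a b edge_of T"
  obtains c where "\<not> collinear {a, b, c}" "T = convex hull {a, b, c}"
proof -
  obtain b' c where *: "\<not> collinear {a, b', c}" "T = convex hull {a, b', c}"
    "closed_segment a b = closed_segment a b'"
    using edge_of_2_simplex[OF assms, of a] by (auto simp: extreme_point_of_segment)
  then have "b = b'" by (auto simp: doubleton_eq_iff)
  with * that show ?thesis by blast
qed

lemma affine_hull_2_neq:
  fixes p :: point
  assumes "\<not> collinear {p, x, y}"
  shows "affine hull {p, x} \<noteq> affine hull {p, y}"
  using assms affine_hull_3_imp_collinear[of y p x] hull_inc[of y "{p, y}" affine] by auto

lemma affine_hull_2_eq:
  fixes p :: point
  assumes "collinear {p, x, y}" "p \<noteq> x" "p \<noteq> y"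
  shows "affine hull {p, x} = affine hull {p, y}"
proof -
  have "affine hull {p, v} \<subseteq> affine hull {p, u}" if "collinear {p, u, v}" "p \<noteq> u" for u v
    using collinear_3_imp_in_affine_hull[OF that]
    by (intro hull_minimal) (auto simp: hull_inc)
  from this[of x y] this[of y x] assms show ?thesis
    by (auto simp: insert_commute)
qed

section \<open>The incenter\<close>

text \<open>Together with \<open>orient_move\<close>: \<open>orient a b\<close> varies at most at rate \<open>norm (b - a)\<close>, and attains
  this rate in the direction normal to the line. So a disc of radius \<open>r\<close> centred at \<open>p\<close> lies on the
  positive side of the line and touches it iff \<open>orient a b p = r * norm (b - a)\<close>.\<close>

lemma orient_diff_le: "\<bar>orient a b x - orient a b y\<bar> \<le> norm (b - a) * dist x y"
proof -
  define w :: point where "w = vector [- (b - a)$2, (b - a)$1]"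
  have "orient a b x - orient a b y = w \<bullet> (x - y)"
    by (simp add: orient_def w_def inner_vec_def sum_2 algebra_simps)
  moreover have "norm w = norm (b - a)"
    by (simp add: w_def norm_vec_def L2_set_def sum_2 power2_commute add.commute)
  ultimately show ?thesis
    using Cauchy_Schwarz_ineq2[of w "x - y"] by (simp add: dist_norm)
qed

lemma orient_move:
  assumes "a \<noteq> b" "0 \<le> r"
  obtains y where "dist p y = r" "orient a b y = orient a b p - r * norm (b - a)"
proof -
  define w :: point where "w = vector [- (b - a)$2, (b - a)$1]"
  have w: "w$1 = - (b$2 - a$2)" "w$2 = b$1 - a$1" by (simp_all add: w_def)
  have nw: "norm w = norm (b - a)"
    by (simp add: w_def norm_vec_def L2_set_def sum_2 power2_commute add.commute)
  have n2: "(norm (b - a))\<^sup>2 = (b$1 - a$1)\<^sup>2 + (b$2 - a$2)\<^sup>2"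
    unfolding power2_norm_eq_inner by (simp add: inner_vec_def sum_2 power2_eq_square)
  have n0: "norm (b - a) \<noteq> 0" using assms by simp
  let ?t = "r / norm (b - a)"
  let ?y = "p - ?t *\<^sub>R w"
  have "dist p ?y = r" using assms n0 by (simp add: dist_norm nw)
  moreover have "orient a b (p - t *\<^sub>R w) = orient a b p - t * (norm (b - a))\<^sup>2" for t
    unfolding n2 by (simp add: orient_def w power2_eq_square algebra_simps)
  moreover have "?t * (norm (b - a))\<^sup>2 = r * norm (b - a)"
    using n0 by (simp add: power2_eq_square)
  ultimately show ?thesis using that by metis
qed

text \<open>The inscribed discs of a triangle are the solutions of a linear system of three equations
  in the centre and the radius.\<close>

lemma inscribed_disc_iff:
  assumes D: "orient a b c > 0"
  shows "inscribed_disc (convex hull {a, b, c}) p r \<longleftrightarrow>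
    0 < r \<and> orient b c p = r * norm (c - b) \<and> orient c a p = r * norm (a - c) \<and>
    orient a b p = r * norm (b - a)"
proof -
  let ?T = "convex hull {a, b, c}"
  have nc: "\<not> collinear {a, b, c}" using D orient_eq_0_iff_collinear[of a b c] by simp
  have T: "x \<in> ?T \<longleftrightarrow> orient b c x \<ge> 0 \<and> orient c a x \<ge> 0 \<and> orient a b x \<ge> 0" for x
    using triangle_iff_orient[OF D] .
  have dist: "a \<noteq> b" "b \<noteq> c" "c \<noteq> a" using D by auto
  have perm: "convex hull {b, c, a} = ?T" "convex hull {c, a, b} = ?T"
    by (simp_all add: insert_commute)
  have D': "orient b c a > 0" "orient c a b > 0"
    using D by (simp_all add: orient_rotate)
  have tangent: "orient x y p = r * norm (y - x)"
    if *: "cball p r \<subseteq> {q. orient x y q \<ge> 0}" "cball p r \<inter> closed_segment x y \<noteq> {}" "x \<noteq> y" "0 < r"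
    for x y
  proof (rule antisym)
    from *(2) obtain q where q: "dist p q \<le> r" "q \<in> closed_segment x y"
      by (auto simp: cball_def)
    have "orient x y p \<le> norm (y - x) * dist p q"
      using orient_diff_le[of x y p q] segment_imp_orient_0[OF q(2)] by simp
    also have "\<dots> \<le> norm (y - x) * r" using q(1) by (intro mult_left_mono) auto
    finally show "orient x y p \<le> r * norm (y - x)" by (simp add: mult.commute)
  next
    obtain q where "dist p q = r" "orient x y q = orient x y p - r * norm (y - x)"
      using orient_move[of x y r p] *(3,4) by (metis less_imp_le)
    then show "r * norm (y - x) \<le> orient x y p" using *(1) by (auto simp: cball_def)
  qed
  show ?thesis
  proof
    assume "inscribed_disc ?T p r"
    then have r: "0 < r" and sub: "cball p r \<subseteq> ?T"
      and "\<forall>e. e edge_of ?T \<longrightarrow> cball p r \<inter> e \<noteq> {}"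
      by (auto simp: inscribed_disc_def)
    then have "cball p r \<inter> closed_segment a b \<noteq> {}" "cball p r \<inter> closed_segment b c \<noteq> {}"
      "cball p r \<inter> closed_segment c a \<noteq> {}"
      using edge_of_segment_triangle[OF nc] by blast+
    moreover have "cball p r \<subseteq> {q. orient a b q \<ge> 0}" "cball p r \<subseteq> {q. orient b c q \<ge> 0}"
      "cball p r \<subseteq> {q. orient c a q \<ge> 0}"
      using sub T by (simp_all add: subset_iff)
    ultimately show "0 < r \<and> orient b c p = r * norm (c - b) \<and> orient c a p = r * norm (a - c) \<and>
      orient a b p = r * norm (b - a)"
      using tangent dist r by blast
  next
    assume R: "0 < r \<and> orient b c p = r * norm (c - b) \<and> orient c a p = r * norm (a - c) \<and>
      orient a b p = r * norm (b - a)"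
    have inside: "orient x y q \<ge> 0" if "orient x y p = r * norm (y - x)" "dist p q \<le> r" for x y q
    proof -
      have "norm (y - x) * dist p q \<le> norm (y - x) * r" using that(2) by (intro mult_left_mono) auto
      then show ?thesis using orient_diff_le[of x y p q] that(1) by (simp add: mult.commute)
    qed
    have sub: "cball p r \<subseteq> ?T"
    proof
      fix q assume "q \<in> cball p r"
      then show "q \<in> ?T" unfolding T using inside R by (auto simp: cball_def)
    qed
    \<comment> \<open>The point of tangency lies on the line of the side; being in \<open>?T\<close>, it lies on the side itself.\<close>
    have touch: "cball p r \<inter> closed_segment x y \<noteq> {}"
      if xyz: "orient x y z > 0" "convex hull {x, y, z} = ?T" and p: "orient x y p = r * norm (y - x)"
      for x y z
    proof -
      have "x \<noteq> y" using xyz by auto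
      then obtain q where q: "dist p q = r" "orient x y q = orient x y p - r * norm (y - x)"
        using orient_move[of x y r p] R by (metis less_imp_le)
      then have "q \<in> closed_segment x y"
        using triangle_orient_0_imp_segment[OF xyz(1)] xyz(2) sub p by auto
      then show ?thesis using q by (auto simp: cball_def)
    qed
    have "cball p r \<inter> e \<noteq> {}" if "e edge_of ?T" for e
      using that touch[OF D refl] touch[OF D'(1) perm(1)] touch[OF D'(2) perm(2)] R
      unfolding edge_of_segment_triangle[OF nc] by metis
    with R sub show "inscribed_disc ?T p r" by (simp add: inscribed_disc_def)
  qed
qed

lemma incenter_triangle_positive:
  fixes a b c :: point
  assumes D: "orient a b c > 0"
  defines "P \<equiv> norm (c - b) + norm (a - c) + norm (b - a)"
  shows "incenter (convex hull {a, b, c}) =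
    (norm (c - b) / P) *\<^sub>R a + (norm (a - c) / P) *\<^sub>R b + (norm (b - a) / P) *\<^sub>R c" (is "_ = ?p")
proof -
  have "a \<noteq> b" using D by auto
  then have P: "P > 0" unfolding P_def
    by (intro add_nonneg_pos) auto
  let ?r = "orient a b c / P"
  have s: "norm (c - b) / P + norm (a - c) / P + norm (b - a) / P = 1"
    using P by (simp add: P_def add_divide_distrib [symmetric])
  have "inscribed_disc (convex hull {a, b, c}) ?p ?r"
    unfolding inscribed_disc_iff[OF D] orient_affine3[OF s]
    using D P by (simp add: orient_rotate[of b c a] orient_rotate[of c a b])
  moreover have "p = ?p" if "inscribed_disc (convex hull {a, b, c}) p r" for p r
  proof -
    have o: "orient b c p = r * norm (c - b)" "orient c a p = r * norm (a - c)"
      "orient a b p = r * norm (b - a)"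
      using that unfolding inscribed_disc_iff[OF D] by auto
    \<comment> \<open>Adding the three equations gives the area as radius times half the perimeter.\<close>
    have "r * P = orient a b c"
      using orient_sum[of b c p a] unfolding o P_def by (simp add: algebra_simps)
    then have r: "r = ?r" using P by (simp add: field_simps)
    show ?thesis
      using barycentric_normalized[of a b c p] D unfolding o by (simp add: r)
  qed
  ultimately show ?thesis
    unfolding incenter_def by (intro the_equality) blast+
qed

text \<open>The weight of each vertex is the length of the opposite side, normalized by the perimeter.\<close>

lemma incenter_triangle:
  fixes a b c :: point
  assumes nc: "\<not> collinear {a, b, c}"
  defines "P \<equiv> norm (c - b) + norm (a - c) + norm (b - a)"
  shows "incenter (convex hull {a, b, c}) =
    (norm (c - b) / P) *\<^sub>R a + (norm (a - c) / P) *\<^sub>R b + (norm (b - a) / P) *\<^sub>R c"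
proof -
  have "orient a b c \<noteq> 0" using nc orient_eq_0_iff_collinear by blast
  then consider "orient a b c > 0" | "orient b a c > 0"
    using orient_rotate[of b c a] orient_rotate[of a c b] orient_swap[of a b c] by fastforce
  then show ?thesis
  proof cases
    case 1
    then show ?thesis unfolding P_def by (rule incenter_triangle_positive)
  next
    case 2
    have "convex hull {b, a, c} = convex hull {a, b, c}" by (simp add: insert_commute)
    with incenter_triangle_positive[OF 2] show ?thesis
      by (simp add: P_def norm_minus_commute[of c a] norm_minus_commute[of b c]
          norm_minus_commute[of a b] ac_simps)
  qed
qed

lemma incenter_barycentric:
  fixes a b c :: point
  assumes nc: "\<not> collinear {a, b, c}"
  obtains u v w where "0 < u" "0 < v" "0 < w" "u + v + w = 1"
    "incenter (convex hull {a, b, c}) = u *\<^sub>R a + v *\<^sub>R b + w *\<^sub>R c"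
proof -
  have "a \<noteq> b" "b \<noteq> c" "c \<noteq> a" using nc by (auto simp: insert_commute)
  then have n: "norm (c - b) > 0" "norm (a - c) > 0" "norm (b - a) > 0" by auto
  let ?P = "norm (c - b) + norm (a - c) + norm (b - a)"
  have "?P > 0" using n by linarith
  then have "0 < norm (c - b) / ?P" "0 < norm (a - c) / ?P" "0 < norm (b - a) / ?P"
    using n divide_pos_pos by blast+
  moreover have "norm (c - b) / ?P + norm (a - c) / ?P + norm (b - a) / ?P = 1"
    using \<open>?P > 0\<close> by (simp add: add_divide_distrib [symmetric])
  ultimately show ?thesis
    by (intro that[OF _ _ _ _ incenter_triangle[OF nc]])
qed

lemma incenter_in_interior:
  fixes a b c :: point
  assumes "\<not> collinear {a, b, c}"
  shows "incenter (convex hull {a, b, c}) \<in> interior (convex hull {a, b, c})"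
  using incenter_barycentric[OF assms] unfolding interior_triangle[OF assms] by metis

text \<open>The angle at \<open>a\<close> between a side and the segment to the incenter is acute. By the weights of
  the incenter, the scalar product is a positive multiple of
  \<open>norm (c - a) * norm (b - a) + (c - a) \<bullet> (b - a)\<close>, and Cauchy--Schwarz is strict for
  noncollinear points.\<close>

lemma incenter_acute:
  fixes a b c :: point
  assumes nc: "\<not> collinear {a, b, c}"
  shows "(incenter (convex hull {a, b, c}) - a) \<bullet> (b - a) > 0"
proof -
  let ?P = "norm (c - b) + norm (a - c) + norm (b - a)"
  let ?p = "incenter (convex hull {a, b, c})"
  have "a \<noteq> b" "b \<noteq> c" "c \<noteq> a" using nc by (auto simp: insert_commute)
  then have n: "norm (c - b) > 0" "norm (a - c) > 0" "norm (b - a) > 0" by auto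
  then have P: "?P > 0" by linarith
  have "?P *\<^sub>R ?p = norm (c - b) *\<^sub>R a + norm (a - c) *\<^sub>R b + norm (b - a) *\<^sub>R c"
    unfolding incenter_triangle[OF nc] using P by (simp add: scaleR_add_right)
  then have "?P *\<^sub>R (?p - a) = norm (a - c) *\<^sub>R (b - a) + norm (b - a) *\<^sub>R (c - a)"
    by (simp add: algebra_simps)
  then have "?P * ((?p - a) \<bullet> (b - a)) =
      (norm (a - c) *\<^sub>R (b - a) + norm (b - a) *\<^sub>R (c - a)) \<bullet> (b - a)"
    by (metis inner_scaleR_left)
  also have "\<dots> = norm (b - a) * (norm (c - a) * norm (b - a) + (c - a) \<bullet> (b - a))"
    unfolding inner_add_left inner_scaleR_left dot_square_norm power2_eq_square
    by (simp add: norm_minus_commute[of a c] distrib_left)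
  also have "\<dots> > 0"
  proof -
    have "\<bar>(c - a) \<bullet> (b - a)\<bar> \<noteq> norm (c - a) * norm (b - a)"
      using nc norm_cauchy_schwarz_equal[of "c - a" "b - a"] collinear_3[of c a b]
      by (simp add: insert_commute)
    then have "\<bar>(c - a) \<bullet> (b - a)\<bar> < norm (c - a) * norm (b - a)"
      using Cauchy_Schwarz_ineq2[of "c - a" "b - a"] by linarith
    then show ?thesis using n by auto
  qed
  finally show ?thesis using P by (simp add: zero_less_mult_iff)
qed

lemma incenter_same_side:
  fixes a b c :: point
  assumes "\<not> collinear {a, b, c}"
  shows "orient a b (incenter (convex hull {a, b, c})) * orient a b c > 0"
proof -
  obtain u v w where "0 < u" "0 < v" "0 < w" "u + v + w = 1"
    and I: "incenter (convex hull {a, b, c}) = u *\<^sub>R a + v *\<^sub>R b + w *\<^sub>R c"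
    using incenter_barycentric[OF assms] .
  moreover have "orient a b c \<noteq> 0" using assms orient_eq_0_iff_collinear by blast
  ultimately show ?thesis
    by (auto simp: orient_affine3 zero_less_mult_iff mult_less_0_iff linorder_neq_iff)
qed

lemma not_collinear_incenter:
  fixes a b c :: point
  assumes "\<not> collinear {a, b, c}"
  shows "\<not> collinear {a, b, incenter (convex hull {a, b, c})}"
  using incenter_same_side[OF assms] orient_eq_0_iff_collinear by force

text \<open>A point of the line through \<open>a\<close> and \<open>b\<close> that makes acute angles at both endpoints lies
  between them.\<close>

lemma foot_in_open_segment:
  fixes a b y :: point
  assumes "orient a b y = 0" "(y - a) \<bullet> (b - a) > 0" "(y - b) \<bullet> (a - b) > 0"
  shows "y \<in> open_segment a b"
proof -
  have ab: "a \<noteq> b" using assms by auto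
  have "collinear {a, y, b}"
    using assms(1) orient_eq_0_iff_collinear[of a b y] by (simp add: insert_commute)
  then obtain u where u: "y = u *\<^sub>R a + (1 - u) *\<^sub>R b"
    using ab by (auto simp: collinear_3_expand)
  have "y - a = (1 - u) *\<^sub>R (b - a)" "y - b = u *\<^sub>R (a - b)"
    unfolding u by (simp_all add: algebra_simps)
  with assms have "(1 - u) * ((b - a) \<bullet> (b - a)) > 0" "u * ((a - b) \<bullet> (a - b)) > 0"
    by simp_all
  moreover have "(b - a) \<bullet> (b - a) > 0" "(a - b) \<bullet> (a - b) > 0"
    using ab by simp_all
  ultimately have "0 < 1 - u" "0 < u"
    using zero_less_mult_pos2 by blast+
  then have "0 < 1 - u" "1 - u < 1" by simp_all
  moreover have "y = (1 - (1 - u)) *\<^sub>R a + (1 - u) *\<^sub>R b" using u by simp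
  ultimately show ?thesis
    using ab unfolding in_segment by blast
qed

lemma open_segment_neq:
  "z \<in> open_segment a b \<Longrightarrow> z \<noteq> a \<and> z \<noteq> b \<and> a \<noteq> b"
  by (auto simp: open_segment_def)

lemma incenter_segment_meets_edge:
  fixes a b c c' :: point
  assumes nc: "\<not> collinear {a, b, c}" "\<not> collinear {a, b, c'}"
    and opp: "orient a b c * orient a b c' < 0"
  defines "p \<equiv> incenter (convex hull {a, b, c})" and "p' \<equiv> incenter (convex hull {a, b, c'})"
  obtains z where "z \<in> open_segment a b" "z \<in> open_segment p p'"
    "closed_segment a b \<inter> closed_segment p p' = {z}"
proof -
  define s where "s = orient a b p"
  define s' where "s' = orient a b p'"
  have ss: "s * orient a b c > 0" "s' * orient a b c' > 0"
    using incenter_same_side nc unfolding s_def s'_def p_def p'_def by blast+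
  then have ss': "s > 0 \<and> s' < 0 \<or> s < 0 \<and> s' > 0"
    using opp by (auto simp: zero_less_mult_iff mult_less_0_iff)
  \<comment> \<open>\<open>s\<close> and \<open>s'\<close> have opposite signs; at parameter \<open>k\<close> the segment meets the line of the edge.\<close>
  define k where "k = s / (s - s')"
  have k: "0 < k" "k < 1" using ss' by (auto simp: k_def field_simps)
  define z where "z = (1 - k) *\<^sub>R p + k *\<^sub>R p'"
  have orient_line: "orient a b ((1 - t) *\<^sub>R p + t *\<^sub>R p') = s - t * (s - s')" for t
    using orient_affine2[of "1 - t" t] by (simp add: s_def s'_def algebra_simps)
  have z0: "orient a b z = 0"
    unfolding z_def orient_line using ss' by (auto simp: k_def)
  have acute: "(p - a) \<bullet> (b - a) > 0" "(p' - a) \<bullet> (b - a) > 0"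
    "(p - b) \<bullet> (a - b) > 0" "(p' - b) \<bullet> (a - b) > 0"
    using incenter_acute[of a b c] incenter_acute[of a b c']
      incenter_acute[of b a c] incenter_acute[of b a c'] nc
    unfolding p_def p'_def by (simp_all add: insert_commute)
  \<comment> \<open>The acute angles at \<open>a\<close> and \<open>b\<close> pass from the two incenters to the convex combination \<open>z\<close>.\<close>
  have "(z - a) = (1 - k) *\<^sub>R (p - a) + k *\<^sub>R (p' - a)" "(z - b) = (1 - k) *\<^sub>R (p - b) + k *\<^sub>R (p' - b)"
    unfolding z_def by (simp_all add: algebra_simps)
  then have za: "(z - a) \<bullet> (b - a) > 0" "(z - b) \<bullet> (a - b) > 0"
    using acute k by (simp_all add: inner_add_left add_pos_pos)
  have zab: "z \<in> open_segment a b" using foot_in_open_segment[OF z0 za] .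
  have "p \<noteq> p'" using ss' by (auto simp: s_def s'_def)
  then have zpp: "z \<in> open_segment p p'"
    using k unfolding in_segment z_def by blast
  have "y = z" if y: "y \<in> closed_segment a b" "y \<in> closed_segment p p'" for y
  proof -
    obtain t where t: "y = (1 - t) *\<^sub>R p + t *\<^sub>R p'"
      using y(2) unfolding in_segment by blast
    have "s - t * (s - s') = 0"
      using segment_imp_orient_0[OF y(1)] unfolding t orient_line .
    then have "t = k" using ss' by (auto simp: k_def field_simps)
    then show ?thesis by (simp add: t z_def)
  qed
  then have "closed_segment a b \<inter> closed_segment p p' = {z}"
    using zab zpp by (auto simp: open_segment_def)
  with zab zpp that show ?thesis by blast
qed

section \<open>Conforming triangulations\<close>

text \<open>A conforming triangulation by nondegenerate triangles of a not further specified plane set.\<close>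

locale planar_triangulation =
  fixes \<T> :: mesh
  assumes triangulation: "triangulation \<T>"
    and simplices: "\<And>T. T \<in> \<T> \<Longrightarrow> 2 simplex T"
begin

lemma convex_mesh: "T \<in> \<T> \<Longrightarrow> convex T"
  using simplices convex_simplex by blast

text \<open>The form in which conformity is used: vertices, edges and triangles of the mesh with
  meeting relative interiors coincide.\<close>

lemma faces_eq:
  assumes "T \<in> \<T>" "T' \<in> \<T>" "F face_of T" "G face_of T'"
    and "x \<in> rel_interior F" "x \<in> rel_interior G"
  shows "F = G"
proof -
  have x: "x \<in> F" "x \<in> G" using assms(5,6) rel_interior_subset by blast+
  have FT: "F \<subseteq> T" "G \<subseteq> T'" using assms(3,4) face_of_imp_subset by blast+
  have faces: "T \<inter> T' face_of T" "T \<inter> T' face_of T'"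
    using triangulation assms(1,2) unfolding triangulation_def by (metis inf_commute)+
  have "F \<subseteq> T \<inter> T'" "G \<subseteq> T \<inter> T'"
    using subset_of_face_of[OF faces(1) FT(1)] subset_of_face_of[OF faces(2) FT(2)] x FT assms(5,6)
    by blast+
  then have "F face_of T \<inter> T'" "G face_of T \<inter> T'"
    using face_of_subset[OF assms(3)] face_of_subset[OF assms(4)] by auto
  then show ?thesis using face_of_eq assms(5,6) by blast
qed

lemma triangles_eq:
  assumes "T \<in> \<T>" "T' \<in> \<T>" "x \<in> interior T" "x \<in> interior T'"
  shows "T = T'"
  using faces_eq[OF assms(1,2) face_of_refl face_of_refl] convex_mesh assms
    interior_subset_rel_interior by blast

text \<open>Triangles on the same side of a common edge overlap near the midpoint of that edge.\<close>

lemma same_side_imp_eq: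
  assumes mem: "convex hull {a, b, c} \<in> \<T>" "convex hull {a, b, c'} \<in> \<T>"
    and nc: "\<not> collinear {a, b, c}" "\<not> collinear {a, b, c'}"
    and side: "orient a b c * orient a b c' > 0"
  shows "convex hull {a, b, c} = convex hull {a, b, c'}"
proof -
  let ?D = "orient a b c"
  have D: "?D \<noteq> 0" using nc orient_eq_0_iff_collinear by blast
  define u where "u = orient b c c' / ?D"
  define v where "v = orient c a c' / ?D"
  define w where "w = orient a b c' / ?D"
  have c': "c' = u *\<^sub>R a + v *\<^sub>R b + w *\<^sub>R c"
    unfolding u_def v_def w_def by (rule barycentric_normalized[OF D])
  have sum: "u + v + w = 1"
    unfolding u_def v_def w_def using orient_sum[of b c c' a] D
    by (simp add: add_divide_distrib[symmetric])
  have w: "w > 0" using side by (auto simp: w_def zero_less_divide_iff zero_less_mult_iff)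
  \<comment> \<open>Small enough that moving from the midpoint of the edge towards \<open>c'\<close> by the fraction \<open>t\<close> keeps the
    barycentric coordinates in \<open>a b c\<close> positive, whatever the signs of \<open>u\<close> and \<open>v\<close>.\<close>
  define t where "t = 1 / (2 + 2 * \<bar>u\<bar> + 2 * \<bar>v\<bar>)"
  have t0: "0 < t" by (simp add: t_def add_pos_nonneg)
  have t1: "t * (2 + 2 * \<bar>u\<bar> + 2 * \<bar>v\<bar>) = 1"
    by (simp add: t_def)
  have "2 * t + 2 * \<bar>t * u\<bar> + 2 * \<bar>t * v\<bar> = 1"
    using t1 t0 by (simp add: abs_mult algebra_simps)
  then have "t < 1" "(1 - t) / 2 + t * u > 0" "(1 - t) / 2 + t * v > 0"
    using t0 by (auto simp: field_simps abs_if split: if_splits)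
  moreover have "t * w > 0" using t0 w by simp
  ultimately have pos: "t < 1" "(1 - t) / 2 + t * u > 0" "(1 - t) / 2 + t * v > 0" "t * w > 0"
    by blast+
  define x where "x = ((1 - t) / 2) *\<^sub>R a + ((1 - t) / 2) *\<^sub>R b + t *\<^sub>R c'"
  have "x \<in> interior (convex hull {a, b, c'})"
    unfolding interior_triangle[OF nc(2)] x_def using pos t0
    by (intro exI[of _ "(1 - t) / 2"] exI[of _ t]) (auto simp: field_simps)
  moreover have "x \<in> interior (convex hull {a, b, c})"
  proof -
    have "x = ((1 - t) / 2 + t * u) *\<^sub>R a + ((1 - t) / 2 + t * v) *\<^sub>R b + (t * w) *\<^sub>R c"
      unfolding x_def by (subst c') (simp add: algebra_simps)
    moreover have "(1 - t) / 2 + t * u + ((1 - t) / 2 + t * v) + t * w = 1 - t + t * (u + v + w)"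
      by (simp add: field_simps)
    then have "(1 - t) / 2 + t * u + ((1 - t) / 2 + t * v) + t * w = 1"
      by (simp add: sum)
    ultimately show ?thesis
      unfolding interior_triangle[OF nc(1)] using pos by metis
  qed
  ultimately show ?thesis using triangles_eq[OF mem] by blast
qed

lemma adjacent_opposite:
  assumes "convex hull {a, b, c} \<in> \<T>" "convex hull {a, b, c'} \<in> \<T>"
    and "\<not> collinear {a, b, c}" "\<not> collinear {a, b, c'}"
    and "convex hull {a, b, c} \<noteq> convex hull {a, b, c'}"
  shows "orient a b c * orient a b c' < 0"
  using same_side_imp_eq[OF assms(1-4)] assms(3-5) orient_eq_0_iff_collinear
  by (metis linorder_neqE_linordered_idom mult_eq_0_iff)

lemma edge_in_two_triangles:
  assumes "T1 \<in> \<T>" "T2 \<in> \<T>" "T3 \<in> \<T>"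
    and "closed_segment a b edge_of T1" "closed_segment a b edge_of T2" "closed_segment a b edge_of T3"
  shows "T1 = T2 \<or> T1 = T3 \<or> T2 = T3"
proof (rule ccontr)
  assume neq: "\<not> ?thesis"
  obtain c1 c2 c3 where "\<not> collinear {a, b, c1}" "T1 = convex hull {a, b, c1}"
    "\<not> collinear {a, b, c2}" "T2 = convex hull {a, b, c2}"
    "\<not> collinear {a, b, c3}" "T3 = convex hull {a, b, c3}"
    using segment_edge_of_2_simplex simplices assms by metis
  then have "orient a b c1 * orient a b c2 < 0" "orient a b c1 * orient a b c3 < 0"
    "orient a b c2 * orient a b c3 < 0"
    using adjacent_opposite neq assms(1-3) by blast+
  \<comment> \<open>Three nonzero reals cannot have pairwise opposite signs.\<close>
  then show False by (auto simp: mult_less_0_iff)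
qed

section \<open>Split points of edges\<close>

lemma split_point_adjacent:
  assumes T: "T \<in> \<T>" "T' \<in> \<T>" "T \<noteq> T'"
    and e: "closed_segment a b edge_of T" "closed_segment a b edge_of T'"
  obtains z where "z \<in> open_segment a b" "z \<in> open_segment (incenter T) (incenter T')"
    "\<And>y. split_point \<T> (closed_segment a b) y \<longleftrightarrow> y = z"
proof -
  obtain c where c: "\<not> collinear {a, b, c}" "T = convex hull {a, b, c}"
    using segment_edge_of_2_simplex[OF simplices[OF T(1)] e(1)] .
  obtain c' where c': "\<not> collinear {a, b, c'}" "T' = convex hull {a, b, c'}"
    using segment_edge_of_2_simplex[OF simplices[OF T(2)] e(2)] .
  obtain z where z: "z \<in> open_segment a b" "z \<in> open_segment (incenter T) (incenter T')"
    "closed_segment a b \<inter> closed_segment (incenter T) (incenter T') = {z}"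
    using incenter_segment_meets_edge[OF c(1) c'(1)] adjacent_opposite T c c' by metis
  have unique: "split_point \<T> (closed_segment a b) y \<longleftrightarrow> y = z" for y
  proof
    assume "split_point \<T> (closed_segment a b) y"
    then obtain T1 T2 where "T1 \<in> \<T>" "T2 \<in> \<T>" "T1 \<noteq> T2" "closed_segment a b edge_of T1"
      "closed_segment a b edge_of T2"
      and y: "y \<in> closed_segment a b \<inter> closed_segment (incenter T1) (incenter T2)"
      unfolding split_point_def using T e by blast
    then have "T1 = T \<and> T2 = T' \<or> T1 = T' \<and> T2 = T"
      using edge_in_two_triangles[of T1 T T' a b] edge_in_two_triangles[of T2 T T' a b] T e by blast
    then have "closed_segment (incenter T1) (incenter T2) = closed_segment (incenter T) (incenter T')"
      by (auto simp: closed_segment_commute)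
    then show "y = z" using y z(3) by blast
  next
    assume "y = z"
    then have "y \<in> closed_segment a b \<inter> closed_segment (incenter T) (incenter T')"
      unfolding z(3) by simp
    then show "split_point \<T> (closed_segment a b) y"
      unfolding split_point_def using T e by (intro disjI1 bexI[of _ T] bexI[of _ T'] conjI)
  qed
  show ?thesis by (rule that[OF z(1,2) unique])
qed

lemma split_point_ex1:
  assumes T: "T \<in> \<T>" and e: "closed_segment a b edge_of T"
  obtains z where "z \<in> open_segment a b" "\<And>y. split_point \<T> (closed_segment a b) y \<longleftrightarrow> y = z"
proof (cases "\<exists>T'\<in>\<T>. T' \<noteq> T \<and> closed_segment a b edge_of T'")
  case True
  then show ?thesis using split_point_adjacent T e that by metis
next
  case False
  have "a \<noteq> b" using segment_edge_of_2_simplex[OF simplices[OF T] e] by fastforce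
  then have mid: "midpoint a b \<in> open_segment a b" by simp
  have ex1: "\<exists>!T. T \<in> \<T> \<and> closed_segment a b edge_of T" using T e False by blast
  have unique: "split_point \<T> (closed_segment a b) y \<longleftrightarrow> y = midpoint a b" for y
  proof -
    have "split_point \<T> (closed_segment a b) y \<longleftrightarrow>
        (\<exists>c d. closed_segment a b = closed_segment c d \<and> y = midpoint c d)"
      unfolding split_point_def using ex1 by blast
    also have "\<dots> \<longleftrightarrow> y = midpoint a b"
      by (auto simp: doubleton_eq_iff midpoint_sym)
    finally show ?thesis .
  qed
  show ?thesis by (rule that[OF mid unique])
qed

text \<open>The segments from a split point to the incenters of the adjacent triangles lie on one line.\<close>

lemma split_point_line:
  assumes T: "T \<in> \<T>" "T' \<in> \<T>"
    and e: "closed_segment a b edge_of T" "closed_segment a b edge_of T'"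
    and z: "split_point \<T> (closed_segment a b) z"
  shows "affine hull {z, incenter T} = affine hull {z, incenter T'}"
proof (cases "T = T'")
  case False
  then have "z \<in> open_segment (incenter T) (incenter T')"
    using split_point_adjacent[OF T _ e] z by metis
  then obtain u where neq: "incenter T \<noteq> incenter T'" "z \<noteq> incenter T" "z \<noteq> incenter T'"
    and u: "z = (1 - u) *\<^sub>R incenter T + u *\<^sub>R incenter T'"
    using open_segment_neq unfolding in_segment by metis
  then have "collinear {incenter T, z, incenter T'}"
    by (auto simp: collinear_3_expand intro!: exI[of _ "1 - u"])
  then show ?thesis
    using affine_hull_2_eq neq by (simp add: insert_commute)
qed simp

section \<open>Subtriangles of the refinement\<close>

text \<open>\<open>flag T a b c z\<close>: \<open>T\<close> is the mesh triangle \<open>a b c\<close>, and \<open>z\<close> is the split point of its edge from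
  \<open>a\<close> to \<open>b\<close>. It stands for the subtriangle with vertices \<open>a\<close>, \<open>z\<close> and the incenter of \<open>T\<close>; the order
  of the first two vertices selects one of the two subtriangles on that edge.\<close>

definition flag :: "point set \<Rightarrow> point \<Rightarrow> point \<Rightarrow> point \<Rightarrow> point \<Rightarrow> bool" where
  "flag T a b c z \<longleftrightarrow> T \<in> \<T> \<and> \<not> collinear {a, b, c} \<and> T = convex hull {a, b, c} \<and>
     split_point \<T> (closed_segment a b) z"

lemma flag_edge: "flag T a b c z \<Longrightarrow> closed_segment a b edge_of T"
  using edge_of_segment_triangle[of a b c] by (auto simp: flag_def)

lemma powell_sabin_eq:
  "powell_sabin \<T> = {convex hull {a, z, incenter T} | T a b c z. flag T a b c z}"
proof (intro equalityI subsetI)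
  fix K assume "K \<in> powell_sabin \<T>"
  then obtain v z T e where *: "K = convex hull {v, z, incenter T}" "T \<in> \<T>" "e edge_of T"
    "v extreme_point_of e" "split_point \<T> e z"
    unfolding powell_sabin_def by blast
  then obtain b c where "\<not> collinear {v, b, c}" "T = convex hull {v, b, c}" "e = closed_segment v b"
    using edge_of_2_simplex simplices by metis
  with * show "K \<in> {convex hull {a, z, incenter T} | T a b c z. flag T a b c z}"
    unfolding flag_def by blast
next
  fix K assume "K \<in> {convex hull {a, z, incenter T} | T a b c z. flag T a b c z}"
  then obtain T a b c z where K: "K = convex hull {a, z, incenter T}" and f: "flag T a b c z"
    by blast
  then have "T \<in> \<T>" "split_point \<T> (closed_segment a b) z" "a extreme_point_of closed_segment a b"
    by (auto simp: flag_def extreme_point_of_segment)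
  with K flag_edge[OF f] show "K \<in> powell_sabin \<T>"
    unfolding powell_sabin_def by blast
qed

lemma flag_exists:
  assumes "T \<in> \<T>" "\<not> collinear {a, b, c}" "T = convex hull {a, b, c}"
  obtains z where "flag T a b c z"
proof -
  have "closed_segment a b edge_of T" using assms edge_of_segment_triangle by blast
  then show ?thesis using split_point_ex1 assms that unfolding flag_def by metis
qed

lemma flag_open_segment:
  assumes "flag T a b c z"
  shows "z \<in> open_segment a b"
proof -
  have T: "T \<in> \<T>" and z: "split_point \<T> (closed_segment a b) z" using assms by (auto simp: flag_def)
  obtain y where "y \<in> open_segment a b" "split_point \<T> (closed_segment a b) z \<longleftrightarrow> z = y"
    using split_point_ex1[OF T flag_edge[OF assms]] by blast
  then show ?thesis using z by simp
qed

lemma flag_line: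
  assumes "flag T a b c z"
  shows "affine hull {a, z} = affine hull {a, b}"
proof -
  have z: "z \<in> open_segment a b" using flag_open_segment[OF assms] .
  then have "orient a b z = 0" using segment_imp_orient_0 by (auto simp: open_segment_def)
  then have "collinear {a, z, b}" by (simp add: orient_eq_0_iff_collinear insert_commute)
  then show ?thesis using affine_hull_2_eq open_segment_neq[OF z] by blast
qed

lemma flag_not_collinear:
  assumes "flag T a b c z"
  shows "\<not> collinear {a, z, incenter T}"
proof
  assume "collinear {a, z, incenter T}"
  moreover have "a \<noteq> z" using open_segment_neq[OF flag_open_segment[OF assms]] by blast
  ultimately have "incenter T \<in> affine hull {a, b}"
    using collinear_3_affine_hull flag_line[OF assms] by blast
  then have "collinear {a, b, incenter T}" by (rule affine_hull_3_imp_collinear)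
  then show False using not_collinear_incenter assms unfolding flag_def by blast
qed

text \<open>The three kinds of vertices of the refinement lie in the relative interiors of faces of
  dimension 0, 1 and 2 of the triangulation, so that \<open>faces_eq\<close> tells them apart.\<close>

lemma flag_relative_interiors:
  assumes "flag T a b c z"
  shows "{a} face_of T" "a \<in> rel_interior {a}"
    and "closed_segment a b face_of T" "z \<in> rel_interior (closed_segment a b)"
    and "T face_of T" "incenter T \<in> rel_interior T"
proof -
  have T: "T = convex hull {a, b, c}" "\<not> collinear {a, b, c}" "T \<in> \<T>"
    using assms by (auto simp: flag_def)
  have "\<not> affine_dependent {a, b, c}" using T collinear_3_eq_affine_dependent by blast
  then show "{a} face_of T"
    unfolding face_of_singleton T(1)
    by (subst extreme_point_of_convex_hull_affine_independent) auto
  show "a \<in> rel_interior {a}" by simp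
  show "closed_segment a b face_of T" using flag_edge[OF assms] by (simp add: edge_of_def)
  show "z \<in> rel_interior (closed_segment a b)"
    using flag_open_segment[OF assms] open_segment_neq by (auto simp: rel_interior_closed_segment)
  show "T face_of T" using T convex_mesh by (simp add: face_of_refl)
  show "incenter T \<in> rel_interior T"
    using incenter_in_interior[OF T(2)] T(1) interior_subset_rel_interior by blast
qed

lemma flag_separated:
  assumes f: "flag T a b c z" and f': "flag T' a' b' c' z'"
  shows "z \<noteq> a'" "z \<noteq> incenter T'" "a \<noteq> incenter T'"
    and "z = z' \<Longrightarrow> closed_segment a b = closed_segment a' b'"
    and "incenter T = incenter T' \<Longrightarrow> T = T'"
proof -
  note r = flag_relative_interiors[OF f] and r' = flag_relative_interiors[OF f']
  have T: "T \<in> \<T>" "T' \<in> \<T>" using f f' by (auto simp: flag_def)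
  note eq = faces_eq[OF T]
  have ab: "a \<noteq> b" and nc': "\<not> collinear {a', b', c'}" and T': "T' = convex hull {a', b', c'}"
    using f f' by (auto simp: flag_def)
  have nT': "\<not> collinear T'"
    using nc' unfolding T' by (metis collinear_subset hull_subset)
  show "z \<noteq> a'" using eq[OF r(3) r'(1)] r(4) r'(2) ab by (metis closed_segment_eq_sing)
  show "z \<noteq> incenter T'" using eq[OF r(3) r'(5)] r(4) r'(6) nT' by (metis collinear_closed_segment)
  show "a \<noteq> incenter T'" using eq[OF r(1) r'(5)] r(2) r'(6) nT' by (metis collinear_sing)
  show "z = z' \<Longrightarrow> closed_segment a b = closed_segment a' b'"
    using eq[OF r(3) r'(3)] r(4) r'(4) by blast
  show "incenter T = incenter T' \<Longrightarrow> T = T'"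
    using eq[OF r(5) r'(5)] r(6) r'(6) by metis
qed

end

section \<open>Disjointness of the subtriangles\<close>

text \<open>Central projection from the vertex \<open>p\<close> to the opposite side.\<close>

lemma cone_point:
  fixes a z p x :: point
  assumes "\<not> collinear {a, z, p}" "x \<in> interior (convex hull {a, z, p})"
  obtains y w where "y \<in> open_segment a z" "0 < w" "w < 1" "x = (1 - w) *\<^sub>R y + w *\<^sub>R p"
proof -
  obtain u v w where uvw: "0 < u" "0 < v" "0 < w" "u + v + w = 1"
    and x: "u *\<^sub>R a + v *\<^sub>R z + w *\<^sub>R p = x"
    using assms(2) unfolding interior_triangle[OF assms(1)] by blast
  define y where "y = (1 - v / (u + v)) *\<^sub>R a + (v / (u + v)) *\<^sub>R z"
  have "a \<noteq> z" using assms(1) by auto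
  moreover have "0 < v / (u + v)" "v / (u + v) < 1" using uvw by auto
  ultimately have y: "y \<in> open_segment a z" unfolding in_segment y_def by blast
  have w: "1 - w = u + v" using uvw by simp
  have "(u + v) *\<^sub>R y = u *\<^sub>R a + v *\<^sub>R z"
    using uvw unfolding y_def by (simp add: scaleR_add_right right_diff_distrib)
  then have "x = (1 - w) *\<^sub>R y + w *\<^sub>R p"
    using x w by simp
  with y uvw that show ?thesis by simp
qed

lemma disjoint_half_segments:
  fixes a b z :: point
  assumes z: "z \<in> open_segment a b"
  shows "open_segment a z \<inter> open_segment b z = {}"
proof -
  have "y \<notin> open_segment b z" if y: "y \<in> open_segment a z" for y
  proof
    assume y': "y \<in> open_segment b z"
    have "dist a z = dist a y + dist y z" "dist b z = dist b y + dist y z" "dist a b = dist a z + dist z b"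
      using y y' z between by (auto simp: between_mem_segment open_segment_def between)
    moreover have "dist a b \<le> dist a y + dist y b" "dist y z > 0"
      using y dist_triangle[of a b y] by (auto simp: open_segment_def)
    ultimately show False by (simp add: dist_commute)
  qed
  then show ?thesis by blast
qed

context planar_triangulation
begin

text \<open>By symmetry in the two representations, a point of \<open>T\<close> determines its weight \<open>w\<close> at the
  incenter, and hence its central projection \<open>y\<close> to the boundary of \<open>T\<close>.\<close>

lemma flag_cone_unique:
  assumes f: "flag T a b c z" and T: "y' \<in> T" 
    and y: "y \<in> closed_segment a b" and w: "w' < 1"
    and eq: "(1 - w) *\<^sub>R y + w *\<^sub>R incenter T = (1 - w') *\<^sub>R y' + w' *\<^sub>R incenter T"
  shows "w' \<le> w"
proof (rule ccontr)
  assume "\<not> w' \<le> w"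
  then have ww: "w < w'" by simp
  let ?p = "incenter T"
  have D: "T \<in> \<T>" "\<not> collinear {a, b, c}" "T = convex hull {a, b, c}"
    using f by (auto simp: flag_def)
  have cT: "convex T" using D convex_mesh by blast
  have pT: "?p \<in> interior T" using incenter_in_interior D by metis
  define k where "k = (w' - w) / (1 - w)"
  have k: "0 < k" "k < 1" using w ww by (auto simp: k_def field_simps)
  have "(1 - w) *\<^sub>R y = (1 - w') *\<^sub>R y' + (w' - w) *\<^sub>R ?p"
    using eq by (simp add: algebra_simps)
  then have "(1 / (1 - w)) *\<^sub>R ((1 - w) *\<^sub>R y) =
      (1 / (1 - w)) *\<^sub>R ((1 - w') *\<^sub>R y' + (w' - w) *\<^sub>R ?p)" by simp
  then have "y = ((1 - w') / (1 - w)) *\<^sub>R y' + k *\<^sub>R ?p"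
    using w ww by (simp add: k_def scaleR_add_right)
  moreover have "(1 - w') / (1 - w) = 1 - k" using w ww by (simp add: k_def field_simps)
  ultimately have yk: "y = (1 - k) *\<^sub>R y' + k *\<^sub>R ?p" by simp
  \<comment> \<open>\<open>y\<close> is pulled off the boundary by a positive weight \<open>k\<close> at the interior point \<open>?p\<close>.\<close>
  have "y \<in> interior T"
  proof (cases "y' = ?p")
    case True
    then have "y = ?p" unfolding yk by (simp add: scaleR_left_diff_distrib)
    then show ?thesis using pT by simp
  next
    case False
    then have "y \<in> open_segment y' ?p" using k yk unfolding in_segment by blast
    then have "y \<in> open_segment ?p y'" by (simp add: open_segment_commute)
    then show ?thesis
      using in_interior_closure_convex_segment[OF cT pT] T closure_subset by blast
  qed
  moreover have "closed_segment a b \<noteq> T"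
    using D collinear_closed_segment[of a b] collinear_subset[of T "{a, b, c}"] hull_subset[of "{a, b, c}" convex] by metis
  then have "closed_segment a b \<inter> interior T = {}"
    using face_of_disjoint_interior flag_edge[OF f] by (auto simp: edge_of_def)
  ultimately show False using y by blast
qed

lemma subtriangle_subset:
  assumes "flag T a b c z"
  shows "convex hull {a, z, incenter T} \<subseteq> T"
proof -
  have D: "\<not> collinear {a, b, c}" "T = convex hull {a, b, c}" using assms by (auto simp: flag_def)
  have z: "z \<in> closed_segment a b" using flag_open_segment[OF assms] by (simp add: open_segment_def)
  moreover have "closed_segment a b \<subseteq> T"
    unfolding D(2) segment_convex_hull by (intro hull_mono) auto
  moreover have "incenter T \<in> T" using incenter_in_interior[OF D(1)] interior_subset D(2) by blast
  ultimately have "{a, z, incenter T} \<subseteq> T" by auto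
  then show ?thesis using D(2) by (intro hull_minimal) auto
qed

lemma subtriangles_disjoint:
  assumes f: "flag T a b c z" and f': "flag T' a' b' c' z'"
    and x: "x \<in> interior (convex hull {a, z, incenter T})"
      "x \<in> interior (convex hull {a', z', incenter T'})"
  shows "T = T' \<and> a = a' \<and> z = z'"
proof -
  have "x \<in> interior T" "x \<in> interior T'"
    using x interior_mono[OF subtriangle_subset[OF f]] interior_mono[OF subtriangle_subset[OF f']] by blast+
  then have TT: "T' = T" using triangles_eq f f' unfolding flag_def by metis
  note f' = f'[unfolded TT]
  obtain y w where y: "y \<in> open_segment a z" and w: "0 < w" "w < 1"
    and xy: "x = (1 - w) *\<^sub>R y + w *\<^sub>R incenter T"
    using cone_point[OF flag_not_collinear[OF f] x(1)] by blast
  obtain y' w' where y': "y' \<in> open_segment a' z'" and w': "0 < w'" "w' < 1"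
    and xy': "x = (1 - w') *\<^sub>R y' + w' *\<^sub>R incenter T"
    using cone_point[OF flag_not_collinear[OF f'] x(2)[unfolded TT]] by blast
  have half: "open_segment p r \<subseteq> open_segment p q" if "r \<in> open_segment p q" for p q r :: point
    using that subset_open_segment[of p r p q] by (auto simp: open_segment_def)
  have yab: "y \<in> open_segment a b" using half[OF flag_open_segment[OF f]] y by blast
  have yab': "y' \<in> open_segment a' b'" using half[OF flag_open_segment[OF f']] y' by blast
  have seg: "closed_segment a b \<subseteq> T" "closed_segment a' b' \<subseteq> T"
    using flag_edge[OF f] flag_edge[OF f'] by (auto simp: edge_of_def dest!: face_of_imp_subset)
  have yT: "y \<in> closed_segment a b" "y' \<in> closed_segment a' b'" "y \<in> T" "y' \<in> T"
    using yab yab' seg by (auto simp: open_segment_def)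
  have "w' \<le> w" using flag_cone_unique[OF f yT(4) yT(1) w'(2)] xy xy' by simp
  moreover have "w \<le> w'" using flag_cone_unique[OF f' yT(3) yT(2) w(2)] xy xy' by simp
  ultimately have "w' = w" by simp
  then have "(1 - w) *\<^sub>R y = (1 - w) *\<^sub>R y'" using xy xy' by (metis add_right_cancel)
  then have yy: "y' = y" using w by simp
  have T: "T \<in> \<T>" using f unfolding flag_def by blast
  have "closed_segment a b = closed_segment a' b'"
  proof (rule faces_eq[OF T T])
    show "closed_segment a b face_of T" "closed_segment a' b' face_of T"
      using flag_edge[OF f] flag_edge[OF f'] by (auto simp: edge_of_def)
    show "y \<in> rel_interior (closed_segment a b)" "y \<in> rel_interior (closed_segment a' b')"
      using yab yab' yy open_segment_neq by (auto simp: rel_interior_closed_segment)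
  qed
  moreover from this have zz: "z' = z"
    using split_point_ex1[OF T flag_edge[OF f]] f f' unfolding flag_def by metis
  ultimately have "a' = a \<or> a' = b" by (auto simp: doubleton_eq_iff)
  moreover have "a' \<noteq> b"
    using disjoint_half_segments[OF flag_open_segment[OF f]] y y' yy zz by auto
  ultimately show ?thesis using TT zz by simp
qed

lemma finite_powell_sabin: "finite (powell_sabin \<T>)"
proof -
  define V where "V = (\<Union>T\<in>\<T>. {v. v extreme_point_of T})"
  define Z where "Z = (\<Union>a\<in>V. \<Union>b\<in>V. {z. \<exists>T c. flag T a b c z})"
  have fT: "finite \<T>" using triangulation by (simp add: triangulation_def)
  have "finite {v. v extreme_point_of T}" if "T \<in> \<T>" for T
    using simplices[OF that] finite_polyhedron_extreme_points simplex_imp_polyhedron by blast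
  then have fV: "finite V" using fT by (simp add: V_def)
  have "finite {z. \<exists>T c. flag T a b c z}" for a b
  proof (cases "\<exists>T c z. flag T a b c z")
    case True
    then obtain T c z where f: "flag T a b c z" by blast
    then have "T \<in> \<T>" unfolding flag_def by blast
    then obtain y where "\<And>x. split_point \<T> (closed_segment a b) x \<longleftrightarrow> x = y"
      using split_point_ex1 flag_edge[OF f] by metis
    then have "{z. \<exists>T c. flag T a b c z} \<subseteq> {y}" by (auto simp: flag_def)
    then show ?thesis using finite_subset by blast
  qed auto
  then have fZ: "finite Z" using fV by (simp add: Z_def)
  have "powell_sabin \<T> \<subseteq> (\<lambda>(a, z, T). convex hull {a, z, incenter T}) ` (V \<times> Z \<times> \<T>)"
  proof
    fix K assume "K \<in> powell_sabin \<T>"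
    then obtain T a b c z where K: "K = convex hull {a, z, incenter T}" and f: "flag T a b c z"
      unfolding powell_sabin_eq by blast
    then have "T \<in> \<T>" "a extreme_point_of T" "b extreme_point_of T"
      unfolding flag_def using extreme_point_of_triangle by metis+
    then have "a \<in> V" "b \<in> V" "T \<in> \<T>" by (auto simp: V_def)
    moreover from this have "z \<in> Z" using f by (auto simp: Z_def)
    ultimately show "K \<in> (\<lambda>(a, z, T). convex hull {a, z, incenter T}) ` (V \<times> Z \<times> \<T>)"
      using K by (auto intro!: image_eqI[of _ _ "(a, z, T)"])
  qed
  then show ?thesis using fV fZ fT finite_subset by blast
qed

text \<open>The straight lines on which the edges of the refinement at \<open>p\<close> fall, whose number decides
  whether \<open>p\<close> is singular.\<close>

definition lines_at :: "point \<Rightarrow> point set set" where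
  "lines_at p = {affine hull e | e. e \<in> mesh_edges (powell_sabin \<T>) \<and> p extreme_point_of e}"

text \<open>The last of these conclusions gives the lines at an incenter, by means of flags with
  different first vertices.\<close>

lemma lines_at_flag:
  assumes "flag T a b c z"
  shows "affine hull {a, b} \<in> lines_at a" "affine hull {a, incenter T} \<in> lines_at a"
    "affine hull {a, b} \<in> lines_at z" "affine hull {z, incenter T} \<in> lines_at z"
    "affine hull {incenter T, a} \<in> lines_at (incenter T)"
proof -
  let ?K = "convex hull {a, z, incenter T}"
  have "?K \<in> powell_sabin \<T>" using assms unfolding powell_sabin_eq by blast
  then have e: "e \<in> mesh_edges (powell_sabin \<T>)" if "e edge_of ?K" for e
    using that by (auto simp: mesh_edges_def)
  have edges: "closed_segment a z edge_of ?K" "closed_segment z (incenter T) edge_of ?K"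
    "closed_segment (incenter T) a edge_of ?K"
    using edge_of_segment_triangle[OF flag_not_collinear[OF assms]] by blast+
  have lines: "affine hull {u, v} \<in> lines_at u" "affine hull {u, v} \<in> lines_at v"
    if "closed_segment u v edge_of ?K" for u v
    unfolding lines_at_def using e[OF that]
    by (auto simp: extreme_point_of_segment intro!: exI[of _ "closed_segment u v"])
  show "affine hull {a, b} \<in> lines_at a" "affine hull {a, b} \<in> lines_at z"
    using lines[OF edges(1)] flag_line[OF assms] by simp_all
  show "affine hull {z, incenter T} \<in> lines_at z" using lines[OF edges(2)] by blast
  show "affine hull {a, incenter T} \<in> lines_at a" "affine hull {incenter T, a} \<in> lines_at (incenter T)"
    using lines[OF edges(3)] by (simp_all add: insert_commute)
qed

lemma lines_at_split_point:
  assumes f: "flag T a b c z"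
  shows "lines_at z = {affine hull {a, b}, affine hull {z, incenter T}}"
proof
  show "{affine hull {a, b}, affine hull {z, incenter T}} \<subseteq> lines_at z"
    using lines_at_flag[OF f] by simp
  show "lines_at z \<subseteq> {affine hull {a, b}, affine hull {z, incenter T}}"
  proof
    fix l assume "l \<in> lines_at z"
    then obtain e K where l: "l = affine hull e" and e: "e edge_of K" "z extreme_point_of e"
      and "K \<in> powell_sabin \<T>"
      by (auto simp: lines_at_def mesh_edges_def)
    then obtain T' a' b' c' z' where K: "K = convex hull {a', z', incenter T'}"
      and f': "flag T' a' b' c' z'"
      unfolding powell_sabin_eq by blast
    have "e = closed_segment a' z' \<or> e = closed_segment z' (incenter T') \<or> e = closed_segment (incenter T') a'"
      using e(1) edge_of_segment_triangle[OF flag_not_collinear[OF f']] K by simp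
    with e(2) flag_separated(1,2)[OF f f']
    have zz: "z' = z" and e': "e = closed_segment a' z' \<or> e = closed_segment z' (incenter T')"
      by (auto simp: extreme_point_of_segment)
    have ab: "closed_segment a b = closed_segment a' b'"
      using flag_separated(4)[OF f f'] zz by simp
    have "affine hull {a', z'} = affine hull {a, b}"
      using flag_line[OF f'] ab by (metis affine_hull_closed_segment)
    moreover have "affine hull {z', incenter T'} = affine hull {z, incenter T}"
      unfolding zz
    proof (rule split_point_line)
      show "T' \<in> \<T>" "T \<in> \<T>" "split_point \<T> (closed_segment a b) z" using f f' by (auto simp: flag_def)
      show "closed_segment a b edge_of T'" "closed_segment a b edge_of T"
        using flag_edge[OF f] flag_edge[OF f'] unfolding ab by blast+
    qed
    ultimately show "l \<in> {affine hull {a, b}, affine hull {z, incenter T}}"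
      using e' l by auto
  qed
qed

text \<open>Each triangle of the refinement has exactly one singular vertex, its split point.\<close>

lemma singular_vertex_iff:
  assumes f: "flag T a b c z" and p: "p extreme_point_of (convex hull {a, z, incenter T})"
  shows "singular_vertex (powell_sabin \<T>) p \<longleftrightarrow> p = z"
proof -
  let ?I = "incenter T"
  have "convex hull {a, z, ?I} \<in> powell_sabin \<T>" using f unfolding powell_sabin_eq by blast
  then have "p \<in> mesh_vertices (powell_sabin \<T>)" using p by (auto simp: mesh_vertices_def)
  then have sing: "singular_vertex (powell_sabin \<T>) p \<longleftrightarrow> card (lines_at p) = 2"
    by (simp add: singular_vertex_def lines_at_def)
  have D: "T \<in> \<T>" "\<not> collinear {a, b, c}" "T = convex hull {a, b, c}"
    using f by (auto simp: flag_def)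
  have perm: "\<not> collinear {b, c, a}" "T = convex hull {b, c, a}"
    "\<not> collinear {c, a, b}" "T = convex hull {c, a, b}" "\<not> collinear {a, c, b}" "T = convex hull {a, c, b}"
    using D by (simp_all add: insert_commute)
  have three: "card L \<noteq> 2" if "{l1, l2, l3} \<subseteq> L" "l1 \<noteq> l2" "l1 \<noteq> l3" "l2 \<noteq> l3" for L and l1 l2 l3 :: "point set"
  proof
    assume "card L = 2"
    then have "card {l1, l2, l3} \<le> 2" using that(1) card_mono[of L] by (metis card.infinite zero_neq_numeral)
    then show False using that(2-) by simp
  qed
  \<comment> \<open>Other subtriangles of \<open>T\<close>: the first two show the lines from the incenter to \<open>b\<close> and \<open>c\<close>, the third
    shows the second side of \<open>T\<close> at \<open>a\<close>.\<close>
  obtain z2 where f2: "flag T b c a z2" using flag_exists D(1) perm(1,2) by blast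
  obtain z3 where f3: "flag T c a b z3" using flag_exists D(1) perm(3,4) by blast
  obtain z4 where f4: "flag T a c b z4" using flag_exists D(1) perm(5,6) by blast
  have ncI: "\<not> collinear {a, b, ?I}" "\<not> collinear {b, c, ?I}" "\<not> collinear {c, a, ?I}" "\<not> collinear {a, c, ?I}"
    using not_collinear_incenter D(2,3) perm by metis+
  then have ncI': "\<not> collinear {?I, a, b}" "\<not> collinear {?I, b, c}" "\<not> collinear {?I, a, c}"
    by (simp_all add: insert_commute)
  have "card (lines_at z) = 2"
  proof -
    have "affine hull {a, b} \<noteq> affine hull {z, ?I}"
    proof
      assume "affine hull {a, b} = affine hull {z, ?I}"
      then have "?I \<in> affine hull {a, b}" by (simp add: hull_inc)
      then show False using affine_hull_3_imp_collinear ncI(1) by blast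
    qed
    then show ?thesis by (simp add: lines_at_split_point[OF f])
  qed
  moreover have "card (lines_at a) \<noteq> 2"
  proof (rule three)
    show "{affine hull {a, b}, affine hull {a, c}, affine hull {a, ?I}} \<subseteq> lines_at a"
      using lines_at_flag[OF f] lines_at_flag[OF f4] by simp
    show "affine hull {a, b} \<noteq> affine hull {a, c}" "affine hull {a, b} \<noteq> affine hull {a, ?I}"
      "affine hull {a, c} \<noteq> affine hull {a, ?I}"
      using affine_hull_2_neq D(2) ncI by blast+
  qed
  moreover have "card (lines_at ?I) \<noteq> 2"
  proof (rule three)
    show "{affine hull {?I, a}, affine hull {?I, b}, affine hull {?I, c}} \<subseteq> lines_at ?I"
      using lines_at_flag[OF f] lines_at_flag[OF f2] lines_at_flag[OF f3] by simp
    show "affine hull {?I, a} \<noteq> affine hull {?I, b}" "affine hull {?I, a} \<noteq> affine hull {?I, c}"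
      "affine hull {?I, b} \<noteq> affine hull {?I, c}"
      using affine_hull_2_neq ncI' by blast+
  qed
  moreover have "p = a \<or> p = z \<or> p = ?I"
    using p extreme_point_of_triangle[OF flag_not_collinear[OF f]] by blast
  ultimately show ?thesis using sing by auto
qed

end

section \<open>Bases of piecewise constants with vanishing alternating sums\<close>

lemma sum_fun_apply: "(\<Sum>i\<in>A. f i) x = (\<Sum>i\<in>A. f i x)"
  by (induction A rule: infinite_finite_induct) auto

lemma theta_sum_eq:
  fixes v :: "nat \<Rightarrow> real"
  shows "(\<Sum>j=1..4. (-1) ^ (j + 1) * v j) = v 1 - v 2 + v 3 - v 4"
    and "(\<Sum>j=1..2. (-1) ^ (j + 1) * v j) = v 1 - v 2"
  by (simp_all add: eval_nat_numeral)

text \<open>What the linear algebra needs of the refinement: finitely many nondegenerate triangles \<open>M\<close> with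
  disjoint interiors, each in the star of exactly one singular vertex. No shared edges enter: of
  the labelling \<open>K\<close> only the bijectivity on each star matters.\<close>

locale labelled_stars =
  fixes \<Omega> :: "point set" and M :: mesh and K :: "point \<Rightarrow> nat \<Rightarrow> point set"
  assumes finite_mesh: "finite M"
    and triangle: "\<And>k. k \<in> M \<Longrightarrow> \<exists>a b c. \<not> collinear {a, b, c} \<and> k = convex hull {a, b, c}"
    and disjoint: "\<And>k k' x. \<lbrakk>k \<in> M; k' \<in> M; x \<in> interior k; x \<in> interior k'\<rbrakk> \<Longrightarrow> k = k'"
    and unique_star: "\<And>k. k \<in> M \<Longrightarrow> \<exists>!z. z \<in> singular_vertices \<Omega> M \<and> k \<in> vertex_star M z"
    and labelling: "star_labelling \<Omega> M K"
begin

abbreviation "S \<equiv> singular_vertices \<Omega> M"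
abbreviation "n \<equiv> star_size \<Omega> M"

lemma n_ge_2: "2 \<le> n z"
  by (simp add: star_size_def)

lemma star_bij: "z \<in> S \<Longrightarrow> bij_betw (K z) {1..n z} (vertex_star M z)"
  using labelling by (simp add: star_labelling_def)

lemma K_in_star: "z \<in> S \<Longrightarrow> j \<in> {1..n z} \<Longrightarrow> K z j \<in> vertex_star M z"
  using star_bij bij_betwE by blast

lemma K_in_mesh: "z \<in> S \<Longrightarrow> j \<in> {1..n z} \<Longrightarrow> K z j \<in> M"
  using K_in_star by (fastforce simp: vertex_star_def)

lemma K_inj:
  assumes "z \<in> S" "j \<in> {1..n z}" "z' \<in> S" "j' \<in> {1..n z'}" "K z j = K z' j'"
  shows "z = z'" "j = j'"
proof -
  show "z = z'"
    using unique_star[OF K_in_mesh[OF assms(1,2)]] K_in_star assms by metis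
  then show "j = j'"
    using star_bij[OF assms(1)] assms unfolding bij_betw_def inj_on_def by blast
qed

lemma K_surj:
  assumes "k \<in> M"
  obtains z j where "z \<in> S" "j \<in> {1..n z}" "k = K z j"
proof -
  obtain z where z: "z \<in> S" "k \<in> vertex_star M z" using unique_star[OF assms] by blast
  then show ?thesis using that bij_betw_imp_surj_on[OF star_bij[OF z(1)]] by blast
qed

lemma interior_nonempty:
  assumes "k \<in> M"
  shows "interior k \<noteq> {}"
proof -
  obtain a b c where abc: "\<not> collinear {a, b, c}" "k = convex hull {a, b, c}"
    using triangle[OF assms] by blast
  have "(1/3) *\<^sub>R a + (1/3) *\<^sub>R b + (1/3) *\<^sub>R c \<in> interior k"
    unfolding abc(2) interior_triangle[OF abc(1)] by (intro exI[of _ "1/3"]) simp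
  then show ?thesis by blast
qed

text \<open>A sample point in the interior of the triangle \<open>K z j\<close>; a piecewise constant is evaluated
  on \<open>K z j\<close> by taking its value there.\<close>

definition pt :: "point \<Rightarrow> nat \<Rightarrow> point" where
  "pt z j = (SOME x. x \<in> interior (K z j))"

lemma pt_interior: "z \<in> S \<Longrightarrow> j \<in> {1..n z} \<Longrightarrow> pt z j \<in> interior (K z j)"
  unfolding pt_def using interior_nonempty[OF K_in_mesh] by (simp add: some_in_eq)

lemma finite_S: "finite S"
proof -
  have "\<exists>k\<in>M. z extreme_point_of k" if "z \<in> S" for z
    using K_in_star[OF that, of 1] n_ge_2[of z] by (force simp: vertex_star_def)
  then have "S \<subseteq> (\<Union>k\<in>M. {z. z extreme_point_of k})" by blast
  moreover have "finite {z. z extreme_point_of k}" if k: "k \<in> M" for k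
  proof -
    obtain a b c where "k = convex hull {a, b, c}" using triangle[OF k] by blast
    then have "{z. z extreme_point_of k} \<subseteq> {a, b, c}"
      using extreme_points_of_convex_hull by blast
    then show ?thesis using finite_subset by blast
  qed
  ultimately show ?thesis using finite_mesh finite_subset by blast
qed

lemma phi_pt:
  assumes "z \<in> S" "j \<in> {1..n z}" "z' \<in> S" "j' \<in> {1..n z'}"
  shows "\<phi> K z j (pt z' j') = (if z = z' \<and> j = j' then 1 else 0)"
proof (cases "z = z' \<and> j = j'")
  case True
  then show ?thesis using pt_interior assms by (simp add: \<phi>_def)
next
  case False
  then have "K z j \<noteq> K z' j'" using K_inj assms by blast
  then have "pt z' j' \<notin> interior (K z j)"
    using disjoint K_in_mesh pt_interior assms by blast
  then show ?thesis using False by (simp add: \<phi>_def)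
qed

text \<open>For \<open>j' \<ge> 2\<close> this is the Kronecker delta: on these triangles the functions are dual to the
  evaluations at the sample points.\<close>

lemma psi_pt:
  assumes "z \<in> S" "j \<in> {2..n z}" "z' \<in> S" "j' \<in> {1..n z'}"
  shows "\<psi> K z j (pt z' j') =
    (if z = z' then if j = j' then 1 else if j' = 1 then (-1) ^ j else 0 else 0)"
  using assms n_ge_2[of z] unfolding \<psi>_def by (auto simp: phi_pt)

lemma phi_piecewise: "\<phi> K z j \<in> piecewise_constants M" if "z \<in> S" "j \<in> {1..n z}"
proof -
  have "\<exists>c. \<forall>x\<in>interior k. \<phi> K z j x = c" if k: "k \<in> M" for k
  proof (cases "k = K z j")
    case False
    then have "x \<notin> interior (K z j)" if "x \<in> interior k" for x
      using disjoint[OF k K_in_mesh[OF \<open>z \<in> S\<close> \<open>j \<in> {1..n z}\<close>] that] by blast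
    then have "\<forall>x\<in>interior k. \<phi> K z j x = 0" by (simp add: \<phi>_def)
    then show ?thesis by blast
  qed (auto simp: \<phi>_def)
  then show ?thesis
    using K_in_mesh[OF that] by (auto simp: piecewise_constants_def \<phi>_def)
qed

lemma subspace_piecewise_constants: "subspace (piecewise_constants M)"
proof (rule subspaceI)
  show "0 \<in> piecewise_constants M" by (auto simp: piecewise_constants_def)
next
  fix p q assume pq: "p \<in> piecewise_constants M" "q \<in> piecewise_constants M"
  have "\<exists>c. \<forall>x\<in>interior k. (p + q) x = c" if k: "k \<in> M" for k
  proof -
    obtain c d where "\<forall>x\<in>interior k. p x = c" "\<forall>x\<in>interior k. q x = d"
      using pq k unfolding piecewise_constants_def by blast
    then show ?thesis by (intro exI[of _ "c + d"]) simp
  qed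
  then show "p + q \<in> piecewise_constants M" using pq by (simp add: piecewise_constants_def)
next
  fix r :: real and q assume q: "q \<in> piecewise_constants M"
  have "\<exists>c. \<forall>x\<in>interior k. (r *\<^sub>R q) x = c" if k: "k \<in> M" for k
  proof -
    obtain c where "\<forall>x\<in>interior k. q x = c" using q k unfolding piecewise_constants_def by blast
    then show ?thesis by (intro exI[of _ "r * c"]) simp
  qed
  then show "r *\<^sub>R q \<in> piecewise_constants M" using q by (simp add: piecewise_constants_def)
qed

lemma piecewise_const_pt:
  assumes "q \<in> piecewise_constants M" "z \<in> S" "j \<in> {1..n z}" "x \<in> interior (K z j)"
  shows "q x = q (pt z j)"
proof -
  obtain c where "\<forall>y\<in>interior (K z j). q y = c"
    using assms(1) K_in_mesh[OF assms(2,3)] unfolding piecewise_constants_def by blast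
  then show ?thesis using pt_interior assms by simp
qed

lemma piecewise_constants_eqI:
  assumes "p \<in> piecewise_constants M" "q \<in> piecewise_constants M"
    and "\<And>z j. z \<in> S \<Longrightarrow> j \<in> {1..n z} \<Longrightarrow> p (pt z j) = q (pt z j)"
  shows "p = q"
proof
  fix x
  show "p x = q x"
  proof (cases "x \<in> (\<Union>k\<in>M. interior k)")
    case True
    then obtain k where "k \<in> M" "x \<in> interior k" by blast
    then obtain z j where "z \<in> S" "j \<in> {1..n z}" "x \<in> interior (K z j)" using K_surj by metis
    then show ?thesis using assms piecewise_const_pt by metis
  next
    case False
    then show ?thesis using assms(1,2) by (simp add: piecewise_constants_def)
  qed
qed

text \<open>The vertex \<open>z\<close> is a limit point of the interior of \<open>K z j\<close>, so that the limit is unique.\<close>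

lemma value_from_pt:
  assumes q: "q \<in> piecewise_constants M" and z: "z \<in> S" and j: "j \<in> {1..n z}"
  shows "value_from q (K z j) z = q (pt z j)"
proof -
  let ?k = "K z j"
  have k: "?k \<in> M" and ext: "z extreme_point_of ?k"
    using K_in_star[OF z j] by (auto simp: vertex_star_def)
  obtain a b c where abc: "?k = convex hull {a, b, c}" using triangle[OF k] by blast
  have "closure (interior ?k) = closure ?k"
    using convex_closure_interior[OF _ interior_nonempty[OF k]] abc by simp
  then have "z \<in> closure (interior ?k)"
    using ext closure_subset by (auto simp: extreme_point_of_def)
  moreover have "z \<notin> interior ?k" using ext extreme_point_not_in_interior by blast
  ultimately have "z islimpt interior ?k" by (simp add: closure_def)
  then have "at z within interior ?k \<noteq> bot" by (simp add: trivial_limit_within)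
  moreover have "(q \<longlongrightarrow> q (pt z j)) (at z within interior ?k)"
    by (rule tendsto_eventually) (auto simp: eventually_at_filter piecewise_const_pt[OF q z j])
  ultimately show ?thesis unfolding value_from_def by (rule tendsto_Lim)
qed

lemma theta_eq_sum:
  assumes q: "q \<in> piecewise_constants M" and z: "z \<in> S"
  shows "\<theta> \<Omega> M K z q = (\<Sum>j=1..n z. (-1) ^ (j + 1) * q (pt z j))"
proof (cases "z \<in> singular_interior \<Omega> M")
  case True
  then have "n z = 4" by (simp add: star_size_def)
  with True show ?thesis
    by (simp only: theta_sum_eq) (simp add: \<theta>_def value_from_pt[OF q z])
next
  case False
  then have "n z = 2" by (simp add: star_size_def)
  with False show ?thesis
    by (simp only: theta_sum_eq) (simp add: \<theta>_def value_from_pt[OF q z])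
qed

lemma Y_hat_iff:
  "q \<in> Y_hat \<Omega> M K \<longleftrightarrow> q \<in> piecewise_constants M \<and>
     (\<forall>z\<in>S. (\<Sum>j=1..n z. (-1) ^ (j + 1) * q (pt z j)) = 0)"
  unfolding Y_hat_def using theta_eq_sum by auto

lemma subspace_Y_hat: "subspace (Y_hat \<Omega> M K)"
proof (rule subspaceI)
  show "0 \<in> Y_hat \<Omega> M K"
    using subspace_0[OF subspace_piecewise_constants] by (simp add: Y_hat_iff)
next
  fix p q assume pq: "p \<in> Y_hat \<Omega> M K" "q \<in> Y_hat \<Omega> M K"
  have "(\<Sum>j=1..n z. (-1) ^ (j + 1) * (p + q) (pt z j)) =
      (\<Sum>j=1..n z. (-1) ^ (j + 1) * p (pt z j)) + (\<Sum>j=1..n z. (-1) ^ (j + 1) * q (pt z j))" for z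
    unfolding plus_fun_apply distrib_left sum.distrib ..
  then show "p + q \<in> Y_hat \<Omega> M K"
    using pq subspace_add[OF subspace_piecewise_constants, of p q] unfolding Y_hat_iff by auto
next
  fix r :: real and q assume q: "q \<in> Y_hat \<Omega> M K"
  have "(\<Sum>j=1..n z. (-1) ^ (j + 1) * (r *\<^sub>R q) (pt z j)) =
      r * (\<Sum>j=1..n z. (-1) ^ (j + 1) * q (pt z j))" for z
    unfolding sum_distrib_left by (intro sum.cong) simp_all
  then show "r *\<^sub>R q \<in> Y_hat \<Omega> M K"
    using q subspace_scale[OF subspace_piecewise_constants, of q r] unfolding Y_hat_iff by auto
qed

text \<open>The alternating sum vanishes iff the first value is determined by the others as shown.\<close>

lemma alternating_split:
  "(\<Sum>j=1..n z. (-1) ^ (j + 1) * (v j :: real)) = v 1 - (\<Sum>j=2..n z. (-1) ^ j * v j)"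
proof -
  have "(\<Sum>j=1..n z. (-1) ^ (j + 1) * v j) = v 1 + (\<Sum>j=Suc 1..n z. (-1) ^ (j + 1) * v j)"
    using n_ge_2[of z] by (subst sum.atLeast_Suc_atMost) auto
  then show ?thesis by (simp add: sum_negf numeral_2_eq_2)
qed

lemma psi_in_Y_hat:
  assumes z: "z \<in> S" and j: "j \<in> {2..n z}"
  shows "\<psi> K z j \<in> Y_hat \<Omega> M K"
  unfolding Y_hat_iff
proof (intro conjI ballI)
  show "\<psi> K z j \<in> piecewise_constants M"
    unfolding \<psi>_def using j n_ge_2[of z]
    by (intro subspace_add subspace_scale subspace_piecewise_constants phi_piecewise z) auto
next
  fix z' assume z': "z' \<in> S"
  have "\<psi> K z j (pt z' 1) = (if z = z' then (-1) ^ j else 0)"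
    using psi_pt[OF z j z', of 1] j n_ge_2[of z'] by auto
  moreover have "(\<Sum>i=2..n z'. (-1) ^ i * \<psi> K z j (pt z' i)) =
      (\<Sum>i=2..n z'. if i = j then if z = z' then (-1) ^ j else 0 else 0)"
    by (intro sum.cong) (auto simp: psi_pt[OF z j z'])
  ultimately show "(\<Sum>i=1..n z'. (-1) ^ (i + 1) * \<psi> K z j (pt z' i)) = 0"
    unfolding alternating_split using j by auto
qed

lemma family_basis_psi:
  "family_basis (\<lambda>(z, j). \<psi> K z j) (SIGMA z : S. {2..n z}) (Y_hat \<Omega> M K)"
proof -
  define I where "I = (SIGMA z : S. {2..n z})"
  define f where "f = (\<lambda>(z, j). \<psi> K z j)"
  define p where "p = (\<lambda>(z, j). pt z j)"
  have fin: "finite I" using finite_S by (simp add: I_def)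
  have delta: "f i (p i') = (if i = i' then 1 else 0)" if "i \<in> I" "i' \<in> I" for i i'
  proof -
    obtain z j z' j' where "i = (z, j)" "z \<in> S" "j \<in> {2..n z}" "i' = (z', j')" "z' \<in> S" "j' \<in> {2..n z'}"
      using \<open>i \<in> I\<close> \<open>i' \<in> I\<close> unfolding I_def by blast
    then show ?thesis using psi_pt[of z j z' j'] by (auto simp: f_def p_def)
  qed
  have inj: "inj_on f I"
    by (rule inj_onI) (metis delta zero_neq_one)
  have "independent (f ` I)"
  proof (rule real_vector.independent_if_scalars_zero)
    show "finite (f ` I)" using fin by simp
    fix c v assume 0: "(\<Sum>v\<in>f ` I. c v *\<^sub>R v) = 0" and "v \<in> f ` I"
    then obtain i where i: "i \<in> I" "v = f i" by blast
    have "0 = (\<Sum>i'\<in>I. c (f i') *\<^sub>R f i') (p i)"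
      using 0 by (simp add: sum.reindex[OF inj])
    also have "\<dots> = (\<Sum>i'\<in>I. if i' = i then c (f i) else 0)"
      unfolding sum_fun_apply by (intro sum.cong) (auto simp: delta i)
    also have "\<dots> = c v" using i fin by simp
    finally show "c v = 0" by simp
  qed
  moreover have "span (f ` I) = Y_hat \<Omega> M K"
  proof
    show "span (f ` I) \<subseteq> Y_hat \<Omega> M K"
      using psi_in_Y_hat by (intro span_minimal subspace_Y_hat) (auto simp: f_def I_def)
    show "Y_hat \<Omega> M K \<subseteq> span (f ` I)"
    proof
      fix q assume q: "q \<in> Y_hat \<Omega> M K"
      define r where "r = (\<Sum>i\<in>I. q (p i) *\<^sub>R f i)"
      have r_span: "r \<in> span (f ` I)"
        unfolding r_def by (intro span_sum span_scale span_base) auto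
      have "q = r"
      proof (rule piecewise_constants_eqI)
        show "q \<in> piecewise_constants M" using q by (simp add: Y_hat_iff)
        have "f i \<in> piecewise_constants M" if "i \<in> I" for i
          using that psi_in_Y_hat by (auto simp: f_def I_def Y_hat_iff)
        then show "r \<in> piecewise_constants M"
          unfolding r_def
          by (intro subspace_sum subspace_scale subspace_piecewise_constants)
      next
        fix z j assume z: "z \<in> S" and j: "j \<in> {1..n z}"
        have "r (pt z j) = (\<Sum>z'\<in>S. \<Sum>i=2..n z'. q (pt z' i) * \<psi> K z' i (pt z j))"
          unfolding r_def sum_fun_apply I_def
          by (subst sum.Sigma) (auto simp: finite_S f_def p_def case_prod_beta)
        also have "\<dots> = (\<Sum>z'\<in>S. if z' = z then \<Sum>i=2..n z. q (pt z i) * \<psi> K z i (pt z j) else 0)"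
          using z j by (intro sum.cong refl) (auto simp: psi_pt intro!: sum.neutral)
        also have "\<dots> = (\<Sum>i=2..n z. q (pt z i) * \<psi> K z i (pt z j))"
          using z finite_S by simp
        also have "\<dots> = q (pt z j)"
        proof (cases "j = 1")
          case True
          have "(\<Sum>i=2..n z. q (pt z i) * \<psi> K z i (pt z j)) = (\<Sum>i=2..n z. (-1) ^ i * q (pt z i))"
            using True by (intro sum.cong) (auto simp: psi_pt z j)
          moreover have "q (pt z 1) - (\<Sum>i=2..n z. (-1) ^ i * q (pt z i)) = 0"
            using q z unfolding Y_hat_iff alternating_split by blast
          ultimately show ?thesis using True by simp
        next
          case False
          have "(\<Sum>i=2..n z. q (pt z i) * \<psi> K z i (pt z j)) =
              (\<Sum>i=2..n z. if i = j then q (pt z j) else 0)"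
            using False by (intro sum.cong) (auto simp: psi_pt[OF z _ z j])
          then show ?thesis using False j by auto
        qed
        finally show "q (pt z j) = r (pt z j)" by simp
      qed
      with r_span show "q \<in> span (f ` I)" by simp
    qed
  qed
  ultimately show ?thesis
    using inj unfolding family_basis_def f_def I_def by blast
qed

end

section \<open>The Powell--Sabin basis\<close>

theorem proposition5p1:
  fixes \<Omega> :: "(real^2) set" and \<T> :: "(real^2) set set" and \<sigma> :: real
    and K :: "real^2 \<Rightarrow> nat \<Rightarrow> (real^2) set"
  assumes "polygonal_domain \<Omega>" and "contractible \<Omega>"
    and "triangulates \<T> \<Omega>" and "shape_regular \<sigma> \<T>"
    and "star_labelling \<Omega> (powell_sabin \<T>) K"
  shows "family_basis (\<lambda>(z, j). \<psi> K z j)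
           (SIGMA z : singular_vertices \<Omega> (powell_sabin \<T>). {2..star_size \<Omega> (powell_sabin \<T>) z})
           (Y_hat \<Omega> (powell_sabin \<T>) K)"
proof -
  have cover: "\<Union>\<T> = closure \<Omega>" using assms(3) by (simp add: triangulates_def)
  interpret planar_triangulation \<T>
    using assms(3) by unfold_locales (auto simp: triangulates_def)
  let ?M = "powell_sabin \<T>"
  have singular: "z \<in> singular_vertices \<Omega> ?M \<longleftrightarrow> z \<in> closure \<Omega> \<and> singular_vertex ?M z" for z
    unfolding singular_vertices_def singular_interior_def singular_boundary_def
    using closure_Un_frontier[of \<Omega>] by blast
  interpret labelled_stars \<Omega> ?M K
  proof
    show "finite ?M" by (rule finite_powell_sabin)
    show "star_labelling \<Omega> ?M K" by (rule assms(5))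
  next
    fix k assume "k \<in> ?M"
    then show "\<exists>a b c. \<not> collinear {a, b, c} \<and> k = convex hull {a, b, c}"
      unfolding powell_sabin_eq using flag_not_collinear by blast
  next
    fix k k' x assume "k \<in> ?M" "k' \<in> ?M" "x \<in> interior k" "x \<in> interior k'"
    then show "k = k'" unfolding powell_sabin_eq using subtriangles_disjoint by blast
  next
    fix k assume k: "k \<in> ?M"
    then obtain T a b c z where k_eq: "k = convex hull {a, z, incenter T}" and f: "flag T a b c z"
      unfolding powell_sabin_eq by blast
    have "z extreme_point_of k"
      unfolding k_eq extreme_point_of_triangle[OF flag_not_collinear[OF f]] by simp
    moreover from this have "z \<in> T"
      using subtriangle_subset[OF f] k_eq by (auto simp: extreme_point_of_def)
    then have "z \<in> closure \<Omega>" using f cover unfolding flag_def by blast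
    ultimately show "\<exists>!z. z \<in> singular_vertices \<Omega> ?M \<and> k \<in> vertex_star ?M z"
      using k singular_vertex_iff[OF f] unfolding singular vertex_star_def k_eq by auto
  qed
  show ?thesis by (rule family_basis_psi)
qed

end
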